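(* A positional numeration system $U$ is Bertrand if and only if one of the following occurs: (1) $U(i)=i+1$ for all $i\ge 0$; (2) there exists a real number $\beta>1$ such that $\mathcal{N}_U=\mathrm{Fac}(S_\beta)$; (3) there exists a real number $\beta>1$ such that $\mathcal{N}_U=\mathrm{Fac}(S'_\beta)$. Moreover, in Case (2) (resp. Case (3)): (a) such a $\beta$ is unique; (b) $A_U=\{0,\ldots,\lceil\beta\rceil-1\}$ (resp. $A_U=\{0,\ldots,\lfloor\beta\rfloor\}$); (c) writing $(a_i)_{i\ge1}=d_\beta^*(1)$ (resp. $(a_i)_{i\ge1}=d_\beta(1)$), we have $U(i)=a_1U(i-1)+a_2U(i-2)+\cdots+a_iU(0)+1$ for all $i\ge 0$ and \[ \lim_{i\to\infty}\frac{U(i)}{\beta^i}=\frac{\beta}{(\beta-1)\sum_{i=1}^\infty i a_i\beta^{-i}}; \] (d) $\lim_{i\to\infty}U(i+1)/U(i)=\beta$.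
   Context: A positional numeration system is an increasing sequence of integers $U=(U(i))_{i\ge 0}$ with $U(0)=1$ and $\sup_i U(i+1)/U(i)<\infty$. The greedy $U$-representation $\mathrm{rep}_U(n)$ of $n\in\mathbb{N}$ is the unique word $a_1\cdots a_\ell$ over $\mathbb{N}$ with $n=\sum_{i=1}^\ell a_iU(\ell-i)$, $a_1\neq 0$, and $\sum_{i=j}^\ell a_iU(\ell-i)<U(\ell-j+1)$ for all $j\in\{1,\ldots,\ell\}$. The alphabet is $A_U=\{0,\ldots,\sup_{i\ge0}\lceil U(i+1)/U(i)\rceil-1\}$ and the numeration language is $\mathcal{N}_U=0^*\mathrm{rep}_U(\mathbb{N})$. $U$ is called Bertrand if for all $w\in A_U^*$, $w\in\mathcal{N}_U\iff w0\in\mathcal{N}_U$. For a real $\beta>1$ and $x\in[0,1]$, the $\beta$-expansion $d_\beta(x)=\varepsilon_1\varepsilon_2\cdots$ is given by $r_0=x$, $\varepsilon_i=\lfloor \beta r_{i-1}\rfloor$, $r_i=\beta r_{i-1}-\varepsilon_i$ for $i\ge1$. The quasi-greedy expansion of $1$ is $d^*_\beta(1)=\lim_{x\to1^-}d_\beta(x)$ (limit in the prefix topology). $\sigma$ is the shift $\sigma(w_1w_2\cdots)=w_2w_3\cdots$; $\le_{\mathrm{lex}}$ is the lexicographic order on infinite words. Define $S_\beta=\{w\in\{0,\ldots,\lceil\beta\rceil-1\}^{\mathbb{N}} : \forall i\ge0,\ \sigma^i(w)\le_{\mathrm{lex}} d^*_\beta(1)\}$ and $S'_\beta=\{w\in\{0,\ldots,\lfloor\beta\rfloor\}^{\mathbb{N}}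 : \forall i\ge0,\ \sigma^i(w)\le_{\mathrm{lex}} d_\beta(1)\}$. $\mathrm{Fac}(S)$ is the set of finite factors of words in $S$. *)

theory Defs
  imports "HOL-Analysis.Analysis" "HOL-Library.Fun_Lexorder"
begin

text \<open>
  Finite words over the natural numbers are lists; infinite words are functions of type
  \<open>nat \<Rightarrow> nat\<close>. Both are indexed from 0, so the \<open>i\<close>-th letter of an infinite word
  \<open>w\<^sub>1w\<^sub>2w\<^sub>3\<dots>\<close> is \<open>w (i - 1)\<close>.
\<close>

section \<open>Positional numeration systems\<close>

definition positional_system :: "(nat \<Rightarrow> nat) \<Rightarrow> bool" where
  "positional_system U \<longleftrightarrow>
     strict_mono U \<and> U 0 = 1 \<and> bdd_above (range (\<lambda>i. real (U (Suc i)) / real (U i)))"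

text \<open>The most significant digit comes first.\<close>

definition is_greedy_rep :: "(nat \<Rightarrow> nat) \<Rightarrow> nat \<Rightarrow> nat list \<Rightarrow> bool" where
  "is_greedy_rep U n w \<longleftrightarrow>
     n = (\<Sum>i<length w. w ! i * U (length w - Suc i)) \<and>
     (w \<noteq> [] \<longrightarrow> hd w \<noteq> 0) \<and>
     (\<forall>j<length w. (\<Sum>i=j..<length w. w ! i * U (length w - Suc i)) < U (length w - j))"

definition greedy_rep :: "(nat \<Rightarrow> nat) \<Rightarrow> nat \<Rightarrow> nat list" where
  "greedy_rep U n = (THE w. is_greedy_rep U n w)"

definition alphabet :: "(nat \<Rightarrow> nat) \<Rightarrow> nat set" where
  "alphabet U = {0..nat ((SUP i. \<lceil>real (U (Suc i)) / real (U i)\<rceil>) - 1)}"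

definition numeration_language :: "(nat \<Rightarrow> nat) \<Rightarrow> nat list set" where
  "numeration_language U = {replicate k 0 @ greedy_rep U n | k n. True}"

definition bertrand :: "(nat \<Rightarrow> nat) \<Rightarrow> bool" where
  "bertrand U \<longleftrightarrow>
     (\<forall>w \<in> lists (alphabet U). w \<in> numeration_language U \<longleftrightarrow> w @ [0] \<in> numeration_language U)"

section \<open>Expansions in a real base\<close>

primrec beta_remainder :: "real \<Rightarrow> real \<Rightarrow> nat \<Rightarrow> real" where
  "beta_remainder \<beta> x 0 = x"
| "beta_remainder \<beta> x (Suc i) =
     \<beta> * beta_remainder \<beta> x i - of_int \<lfloor>\<beta> * beta_remainder \<beta> x i\<rfloor>"

definition beta_expansion :: "real \<Rightarrow> real \<Rightarrow> nat \<Rightarrow> nat" where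
  "beta_expansion \<beta> x i = nat \<lfloor>\<beta> * beta_remainder \<beta> x i\<rfloor>"

text \<open>
  The topology on \<open>nat \<Rightarrow> nat\<close> is the product of the discrete topologies, that is, the prefix
  topology. (The library has no \<open>t2_space\<close> instance for functions, so \<open>Lim\<close> is not available.)
\<close>

definition quasi_greedy :: "real \<Rightarrow> nat \<Rightarrow> nat" where
  "quasi_greedy \<beta> = (THE d. (beta_expansion \<beta> \<longlongrightarrow> d) (at_left 1))"

definition lex_le :: "(nat \<Rightarrow> nat) \<Rightarrow> (nat \<Rightarrow> nat) \<Rightarrow> bool" where
  "lex_le v w \<longleftrightarrow> v = w \<or> less_fun v w"

definition shift :: "nat \<Rightarrow> (nat \<Rightarrow> nat) \<Rightarrow> (nat \<Rightarrow> nat)" where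
  "shift i w = (\<lambda>k. w (i + k))"

definition S :: "real \<Rightarrow> (nat \<Rightarrow> nat) set" where
  "S \<beta> = {w. range w \<subseteq> {0..nat (\<lceil>\<beta>\<rceil> - 1)} \<and> (\<forall>i. lex_le (shift i w) (quasi_greedy \<beta>))}"

definition S' :: "real \<Rightarrow> (nat \<Rightarrow> nat) set" where
  "S' \<beta> = {w. range w \<subseteq> {0..nat \<lfloor>\<beta>\<rfloor>} \<and> (\<forall>i. lex_le (shift i w) (beta_expansion \<beta> 1))}"

definition Fac :: "(nat \<Rightarrow> nat) set \<Rightarrow> nat list set" where
  "Fac X = {map w [i..<i + n] | w i n. w \<in> X}"

section \<open>Existence of the quasi-greedy expansion\<close>

lemma tendsto_coordinatewise_iff:
  fixes f :: "'a \<Rightarrow> 'b \<Rightarrow> 'c::topological_space"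
  shows "(f \<longlongrightarrow> d) F \<longleftrightarrow> (\<forall>i. ((\<lambda>x. f x i) \<longlongrightarrow> d i) F)"
  using limitin_componentwise[of "\<lambda>_. euclidean" UNIV f d F]
  by (simp add: euclidean_product_topology)

lemma floor_at_left:
  fixes y :: "'a \<Rightarrow> real"
  assumes "filterlim y (at_left L) F"
  shows "\<forall>\<^sub>F x in F. \<lfloor>y x\<rfloor> = \<lceil>L\<rceil> - 1"
proof -
  have "\<forall>\<^sub>F z in at_left L. z \<in> {of_int \<lceil>L\<rceil> - 1 <..< L}"
    by (rule eventually_at_leftI[of "of_int \<lceil>L\<rceil> - 1"]) (assumption, linarith)
  then have "\<forall>\<^sub>F z in at_left L. \<lfloor>z\<rfloor> = \<lceil>L\<rceil> - 1"
    by (rule eventually_mono) (simp, linarith)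
  with assms show ?thesis unfolding filterlim_iff by blast
qed

lemma beta_remainder_at_left:
  assumes "\<beta> > 1"
  shows "\<exists>L. filterlim (\<lambda>x. beta_remainder \<beta> x i) (at_left L) (at_left 1)"
proof (induction i)
  case 0
  show ?case unfolding beta_remainder.simps by (rule exI, rule filterlim_ident)
next
  case (Suc i)
  then obtain L where L: "filterlim (\<lambda>x. beta_remainder \<beta> x i) (at_left L) (at_left 1)" by blast
  let ?y = "\<lambda>x. \<beta> * beta_remainder \<beta> x i"
  have y: "filterlim ?y (at_left (\<beta> * L)) (at_left 1)"
    using L assms unfolding filterlim_at
    by (auto intro!: tendsto_mult elim: eventually_mono)
  let ?c = "\<lceil>\<beta> * L\<rceil> - 1"
  have "filterlim (\<lambda>x. ?y x - of_int ?c) (at_left (\<beta> * L - of_int ?c)) (at_left 1)"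
    using y unfolding filterlim_at
    by (auto intro!: tendsto_diff elim: eventually_mono)
  moreover have "\<forall>\<^sub>F x in at_left 1. ?y x - of_int ?c = beta_remainder \<beta> x (Suc i)"
    using floor_at_left[OF y] by (rule eventually_mono) simp
  ultimately have "filterlim (\<lambda>x. beta_remainder \<beta> x (Suc i)) (at_left (\<beta> * L - of_int ?c)) (at_left 1)"
    by (simp only: filterlim_cong[OF refl refl])
  then show ?case by (rule exI)
qed

lemma quasi_greedy_unique:
  assumes "\<beta> > 1"
  shows "\<exists>!d. (beta_expansion \<beta> \<longlongrightarrow> d) (at_left 1)"
proof -
  have "\<exists>c. ((\<lambda>x. beta_expansion \<beta> x i) \<longlongrightarrow> c) (at_left 1)" for i
  proof -
    obtain L where L: "filterlim (\<lambda>x. beta_remainder \<beta> x i) (at_left L) (at_left 1)"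
      using beta_remainder_at_left[OF assms] by blast
    have y: "filterlim (\<lambda>x. \<beta> * beta_remainder \<beta> x i) (at_left (\<beta> * L)) (at_left 1)"
      using L assms unfolding filterlim_at
      by (auto intro!: tendsto_mult elim: eventually_mono)
    have "\<forall>\<^sub>F x in at_left 1. beta_expansion \<beta> x i = nat (\<lceil>\<beta> * L\<rceil> - 1)"
      using floor_at_left[OF y] by (rule eventually_mono) (simp add: beta_expansion_def)
    then show ?thesis by (intro exI, rule tendsto_eventually)
  qed
  then obtain d where "\<And>i. ((\<lambda>x. beta_expansion \<beta> x i) \<longlongrightarrow> d i) (at_left 1)"
    by (rule that[OF someI_ex])
  then have lim: "(beta_expansion \<beta> \<longlongrightarrow> d) (at_left 1)"
    by (simp add: tendsto_coordinatewise_iff)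
  show ?thesis
  proof (rule ex1I[of _ d])
    show "(beta_expansion \<beta> \<longlongrightarrow> d) (at_left 1)" by (fact lim)
  next
    fix d' assume lim': "(beta_expansion \<beta> \<longlongrightarrow> d') (at_left 1)"
    show "d' = d"
    proof
      fix i
      have "((\<lambda>x. beta_expansion \<beta> x i) \<longlongrightarrow> d' i) (at_left 1)"
        using lim' by (simp add: tendsto_coordinatewise_iff)
      moreover have "((\<lambda>x. beta_expansion \<beta> x i) \<longlongrightarrow> d i) (at_left 1)"
        using lim by (simp add: tendsto_coordinatewise_iff)
      ultimately show "d' i = d i"
        by (rule tendsto_unique[OF trivial_limit_at_left_real])
    qed
  qed
qed

end

theory Submission
  imports Defs
begin

text \<open>
  Among words of equal length with greedy tails, numerical order is lexicographic order, so
  \<open>numeration_language U\<close> is determined by the words of value \<open>U n - 1\<close>, the maximal words of each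
  length \<open>n\<close>. The Bertrand condition says exactly that these are the prefixes of one infinite word
  \<open>d\<close>, and then all shifts of \<open>d\<close> are lexicographically at most \<open>d\<close>. Unless \<open>d\<close> is \<open>1000\<dots>\<close>, it has
  value 1 in some base \<open>\<beta> > 1\<close>, and by an argument of Parry it is the quasi-greedy expansion of 1 if
  no remainder vanishes and the greedy one otherwise. The recurrence for \<open>U\<close> states that the maximal
  word has value \<open>U n - 1\<close>; divided by \<open>\<beta> ^ n\<close> it is a renewal equation, whose limit is found as in
  the renewal theorem of Erdos, Feller and Pollard.
\<close>

section \<open>Lexicographic order\<close>

lemma lex_le_refl [simp]: "lex_le f f"
  by (simp add: lex_le_def)

lemma lex_le_trans: "lex_le f g \<Longrightarrow> lex_le g h \<Longrightarrow> lex_le f h"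
  unfolding lex_le_def using less_fun_trans by blast

lemma lex_le_antisym: "lex_le f g \<Longrightarrow> lex_le g f \<Longrightarrow> f = g"
  unfolding lex_le_def using less_fun_asym by blast

lemma lex_le_or_less_fun: "lex_le f g \<or> less_fun g f"
proof (cases "f = g")
  case False
  define k where "k = (LEAST k. f k \<noteq> g k)"
  obtain i where "f i \<noteq> g i" using False by auto
  then have "f k \<noteq> g k" unfolding k_def by (rule LeastI)
  moreover have "\<forall>k'<k. f k' = g k'" unfolding k_def using not_less_Least by blast
  ultimately have "less_fun f g \<or> less_fun g f"
    unfolding less_fun_def by (cases "f k" "g k" rule: linorder_cases) auto
  then show ?thesis unfolding lex_le_def by blast
qed simp

lemma not_lex_le_iff: "\<not> lex_le f g \<longleftrightarrow> less_fun g f"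
  by (metis less_fun_asym less_fun_irrefl lex_le_def lex_le_or_less_fun)

lemma lex_leI_pointwise: "(\<And>k. f k \<le> g k) \<Longrightarrow> lex_le f g"
  using lex_le_or_less_fun[of f g] leD by (auto simp: less_fun_def)

lemma lex_le_head: "lex_le f g \<Longrightarrow> f 0 \<le> g 0"
  by (metis gr0I lex_le_def less_fun_def less_imp_le order_refl)

text \<open>The first difference either survives the truncation or is erased with everything after
  it, and then the truncated words coincide.\<close>

lemma lex_le_truncate:
  assumes "lex_le f g"
  shows "lex_le (\<lambda>i. if i < n then f i else 0) (\<lambda>i. if i < n then g i else 0)"
proof (cases "f = g")
  case False
  then obtain k where k: "f k < g k" "\<forall>k'<k. f k' = g k'"
    using assms unfolding lex_le_def less_fun_def by blast
  show ?thesis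
  proof (cases "k < n")
    case True
    then show ?thesis using k unfolding lex_le_def less_fun_def by (intro disjI2 exI[of _ k]) simp
  next
    case False
    then have "(\<lambda>i. if i < n then f i else 0) = (\<lambda>i. if i < n then g i else 0)"
      using k by auto
    then show ?thesis by (simp only: lex_le_refl)
  qed
qed (simp only: lex_le_refl)

text \<open>The words below a bound form a closed set: a violation at position \<open>k\<close> is
  already visible in the truncation to \<open>k + 1\<close> letters.\<close>

lemma lex_le_limit:
  assumes "\<And>n. lex_le (\<lambda>i. if i < n then f i else 0) g"
  shows "lex_le f g"
proof (rule ccontr)
  assume "\<not> lex_le f g"
  then obtain k where k: "g k < f k" "\<forall>k'<k. g k' = f k'"
    unfolding not_lex_le_iff less_fun_def by blast
  have "less_fun g (\<lambda>i. if i < Suc k then f i else 0)"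
    unfolding less_fun_def using k by (intro exI[of _ k]) simp
  then show False using assms[of "Suc k"] not_lex_le_iff by blast
qed

lemma shift_shift [simp]: "shift i (shift j w) = shift (j + i) w"
  by (simp add: shift_def add.assoc)

lemma shift_0 [simp]: "shift 0 w = w"
  by (simp add: shift_def)

section \<open>Finite words as eventually zero infinite words\<close>

text \<open>Padding by zeros lets finite words share the order of infinite ones and makes a word
  \<open>w\<close> and \<open>w @ [0]\<close> indistinguishable, which is what the Bertrand
  condition compares.\<close>

definition pad :: "nat list \<Rightarrow> nat \<Rightarrow> nat" where
  "pad w i = (if i < length w then w ! i else 0)"

abbreviation pref :: "(nat \<Rightarrow> nat) \<Rightarrow> nat \<Rightarrow> nat list" where
  "pref d n \<equiv> map d [0..<n]"

lemma pad_append_0 [simp]: "pad (w @ [0]) = pad w"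
  by (auto simp: pad_def nth_append fun_eq_iff)

lemma pad_pref: "pad (pref d n) = (\<lambda>i. if i < n then d i else 0)"
  by (auto simp: pad_def)

lemma shift_pad: "shift j (pad w) = pad (drop j w)"
  by (auto simp: shift_def pad_def fun_eq_iff)

lemma pref_pad: "pref (pad w) (length w) = w"
  by (auto simp: pad_def intro: nth_equalityI)

lemma pad_inj: "pad v = pad w \<Longrightarrow> length v = length w \<Longrightarrow> v = w"
  by (metis pref_pad)

lemma pad_pref_le: "lex_le (pad (pref d n)) d"
  by (rule lex_leI_pointwise) (simp add: pad_pref)

lemma pad_le_pref:
  assumes "lex_le (pad w) d"
  shows "lex_le (pad w) (pad (pref d (length w)))"
proof -
  have "(\<lambda>i. if i < length w then pad w i else 0) = pad w" by (auto simp: pad_def)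
  then show ?thesis using lex_le_truncate[OF assms, of "length w"] by (simp add: pad_pref)
qed

definition subshift_words :: "(nat \<Rightarrow> nat) \<Rightarrow> nat list set" where
  "subshift_words d = {w. \<forall>i. lex_le (shift i (pad w)) d}"

lemma subshift_words_drop: "w \<in> subshift_words d \<Longrightarrow> drop j w \<in> subshift_words d"
  unfolding subshift_words_def by (simp flip: shift_pad)

lemma subshift_words_append_0: "w @ [0] \<in> subshift_words d \<longleftrightarrow> w \<in> subshift_words d"
  by (simp add: subshift_words_def)

text \<open>Replacing everything after a factor by zeros can only lower its shifts, so the padded
  factor still satisfies every bound. Conversely a padded word is itself a point of the subshift
  with the finite word as its prefix.\<close>

lemma Fac_subshift: "Fac {w. \<forall>i. lex_le (shift i w) d} = subshift_words d" (is "Fac ?X = _")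
proof (intro equalityI subsetI)
  fix v assume "v \<in> Fac ?X"
  then obtain w i n where v: "v = map w [i..<i + n]" and w: "w \<in> ?X"
    unfolding Fac_def by blast
  have "lex_le (shift j (pad v)) d" for j
  proof (rule lex_le_trans)
    show "lex_le (shift j (pad v)) (shift (i + j) w)"
      by (rule lex_leI_pointwise) (auto simp: v pad_def shift_def add.assoc)
    show "lex_le (shift (i + j) w) d" using w by simp
  qed
  then show "v \<in> subshift_words d" by (simp add: subshift_words_def)
next
  fix v assume "v \<in> subshift_words d"
  then have "pad v \<in> ?X" by (simp add: subshift_words_def)
  moreover have "v = map (pad v) [0..<0 + length v]" using pref_pad by simp
  ultimately show "v \<in> Fac ?X" unfolding Fac_def by blast
qed

text \<open>Comparing the first letters of each shift bounds every letter by \<open>d 0\<close>. The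
  explicit alphabets in \<open>S\<close> and \<open>S'\<close> are thus implied by the lexicographic
  conditions.\<close>

lemma subshift_range:
  assumes "\<forall>i. lex_le (shift i w) d"
  shows "range w \<subseteq> {0..d 0}"
  using assms lex_le_head[of "shift _ w" d] by (auto simp: shift_def)

text \<open>Cutting off letters only lowers a word, which gives one direction. For the other, each
  shift of \<open>d\<close> is the limit of shifts of padded prefixes.\<close>

lemma pref_in_subshift_words_iff:
  "(\<forall>n. pref d n \<in> subshift_words d) \<longleftrightarrow> (\<forall>i. lex_le (shift i d) d)"
proof (intro iffI allI)
  fix i assume *: "\<forall>n. pref d n \<in> subshift_words d"
  show "lex_le (shift i d) d"
  proof (rule lex_le_limit)
    fix n
    have "shift i (pad (pref d (i + n))) = (\<lambda>k. if k < n then shift i d k else 0)"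
      by (auto simp: pad_pref shift_def)
    moreover have "lex_le (shift i (pad (pref d (i + n)))) d"
      using * unfolding subshift_words_def by blast
    ultimately show "lex_le (\<lambda>k. if k < n then shift i d k else 0) d" by simp
  qed
next
  fix n assume *: "\<forall>i. lex_le (shift i d) d"
  have "lex_le (shift i (pad (pref d n))) d" for i
    by (rule lex_le_trans[OF lex_leI_pointwise *[rule_format, of i]])
      (simp add: pad_pref shift_def)
  then show "pref d n \<in> subshift_words d" by (simp add: subshift_words_def)
qed

section \<open>Greedy words\<close>

primrec word_val :: "(nat \<Rightarrow> nat) \<Rightarrow> nat list \<Rightarrow> nat" where
  "word_val U [] = 0"
| "word_val U (a # w) = a * U (length w) + word_val U w"

text \<open>This keeps the inequalities of \<open>is_greedy_rep\<close> but drops the condition on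
  the leading digit, so that leading zeros are allowed as in
  \<open>numeration_language\<close>.\<close>

primrec greedy :: "(nat \<Rightarrow> nat) \<Rightarrow> nat list \<Rightarrow> bool" where
  "greedy U [] \<longleftrightarrow> True"
| "greedy U (a # w) \<longleftrightarrow> a * U (length w) + word_val U w < U (Suc (length w)) \<and> greedy U w"

lemma word_val_eq_sum: "word_val U w = (\<Sum>i<length w. w ! i * U (length w - Suc i))"
  by (induction w) (simp_all only: word_val.simps list.size add_0_right add_Suc_right
      sum.lessThan_Suc_shift nth_Cons_0 nth_Cons_Suc diff_Suc_Suc diff_zero, simp_all)

lemma greedy_iff_sum:
  "greedy U w \<longleftrightarrow>
    (\<forall>j<length w. (\<Sum>i=j..<length w. w ! i * U (length w - Suc i)) < U (length w - j))"
proof (induction w)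
  case (Cons a w)
  have "(\<Sum>i=Suc j..<length (a # w). (a # w) ! i * U (length (a # w) - Suc i))
      = (\<Sum>i=j..<length w. w ! i * U (length w - Suc i))" for j
    by (simp only: list.size add_0_right add_Suc_right sum.shift_bounds_Suc_ivl
        nth_Cons_Suc diff_Suc_Suc)
  note tail = this
  have head: "(\<Sum>i=0..<length (a # w). (a # w) ! i * U (length (a # w) - Suc i))
      = a * U (length w) + word_val U w"
    by (metis atLeast0LessThan word_val.simps(2) word_val_eq_sum)
  have "(\<forall>j<Suc n. P j) \<longleftrightarrow> P 0 \<and> (\<forall>j<n. P (Suc j))" for n P
    by (rule All_less_Suc2)
  from this[of "length w"] show ?case
    by (simp only: greedy.simps Cons.IH head[unfolded length_Cons diff_Suc_Suc]
        tail[unfolded length_Cons diff_Suc_Suc]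
        length_Cons diff_Suc_Suc diff_zero)
qed simp

lemma is_greedy_rep_iff:
  "is_greedy_rep U n w \<longleftrightarrow> n = word_val U w \<and> (w \<noteq> [] \<longrightarrow> hd w \<noteq> 0) \<and> greedy U w"
  unfolding is_greedy_rep_def word_val_eq_sum greedy_iff_sum by blast

lemma greedy_drop: "greedy U w \<Longrightarrow> greedy U (drop j w)"
proof (induction w arbitrary: j)
  case (Cons a w)
  then show ?case by (cases j) auto
qed simp

section \<open>Greedy words of a fixed system: order, existence, uniqueness\<close>

locale numeration =
  fixes U :: "nat \<Rightarrow> nat"
  assumes strict_mono_U: "strict_mono U" and U_0 [simp]: "U 0 = 1"
begin

lemma U_pos: "U n > 0"
  using strict_mono_less_eq[OF strict_mono_U, of 0 n] by simp

lemma U_less_Suc: "U n < U (Suc n)"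
  using strict_mono_U by (simp add: strict_mono_Suc_iff)

lemma greedy_val_less: "greedy U w \<Longrightarrow> word_val U w < U (length w)"
  by (cases w) auto

lemma greedy_append_zeros:
  "greedy U (replicate k 0 @ w) \<longleftrightarrow> greedy U w"
proof (induction k)
  case (Suc k)
  then show ?case using greedy_val_less[of "replicate k 0 @ w"] U_less_Suc[of "k + length w"]
    by auto
qed simp

lemma word_val_append_zeros: "word_val U (replicate k 0 @ w) = word_val U w"
  by (induction k) auto

text \<open>At the first difference the larger digit gains at least one full unit of its weight, and
  a greedy remainder of \<open>v\<close> is worth less than that unit. Only the tail of
  \<open>v\<close> has to be greedy, so the lemma can serve to prove that \<open>v\<close> itself
  is.\<close>

lemma word_val_mono_lex:
  assumes "greedy U (tl v)" "length v = length w" "less_fun (pad v) (pad w)"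
  shows "word_val U v < word_val U w"
  using assms(2,1,3)
proof (induction v w rule: list_induct2)
  case Nil
  then show ?case by (simp add: less_fun_irrefl)
next
  case (Cons a v b w)
  from Cons.prems(2) obtain k where
    k: "pad (a # v) k < pad (b # w) k" "\<forall>k'<k. pad (a # v) k' = pad (b # w) k'"
    unfolding less_fun_def by blast
  show ?case
  proof (cases k)
    case 0
    then have "a < b" using k by (simp add: pad_def)
    have "a * U (length v) + word_val U v < a * U (length v) + U (length v)"
      using Cons.prems greedy_val_less[of v] by simp
    also have "\<dots> = Suc a * U (length v)" by simp
    also have "\<dots> \<le> b * U (length v)" using \<open>a < b\<close> by (intro mult_le_mono1) simp
    finally show ?thesis using Cons.hyps by simp
  next
    case (Suc m)
    then have "a = b" using k(2) by (auto simp: pad_def)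
    have "pad (c # u) (Suc i) = pad u i" for c u i by (simp add: pad_def)
    then have "less_fun (pad v) (pad w)"
      unfolding less_fun_def using k Suc by (intro exI[of _ m]) (metis Suc_less_eq)
    moreover have "greedy U (tl v)" using Cons.prems greedy_drop[of U v 1] by (simp add: drop_Suc)
    ultimately show ?thesis using Cons \<open>a = b\<close> by simp
  qed
qed

lemma greedy_tl: "greedy U w \<Longrightarrow> greedy U (tl w)"
  by (cases w) auto

lemma lex_le_if_val_le:
  assumes "greedy U w" "length v = length w" "word_val U v \<le> word_val U w"
  shows "lex_le (pad v) (pad w)"
  using word_val_mono_lex[of w v] assms greedy_tl lex_le_or_less_fun leD by metis

lemma word_val_le_if_lex_le:
  assumes "greedy U (tl v)" "length v = length w" "lex_le (pad v) (pad w)"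
  shows "word_val U v \<le> word_val U w"
  using word_val_mono_lex[of v w] assms pad_inj unfolding lex_le_def
  by (metis less_imp_le order_refl)

lemma greedy_val_inj:
  "greedy U v \<Longrightarrow> greedy U w \<Longrightarrow> length v = length w \<Longrightarrow> word_val U v = word_val U w \<Longrightarrow> v = w"
  using lex_le_if_val_le lex_le_antisym pad_inj by (metis order_refl)

text \<open>The greedy algorithm: the leading digit is \<open>m div U n\<close>, and the remainder
  \<open>m mod U n\<close> is below \<open>U n\<close>, so the induction hypothesis represents
  it.\<close>

lemma greedy_word_exists:
  "m < U n \<Longrightarrow> \<exists>w. length w = n \<and> greedy U w \<and> word_val U w = m"
proof (induction n arbitrary: m)
  case (Suc n)
  obtain w where "length w = n" "greedy U w" "word_val U w = m mod U n"
    using Suc.IH[of "m mod U n"] U_pos by auto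
  then show ?case using Suc.prems by (intro exI[of _ "(m div U n) # w"]) simp
qed simp

lemma strip_zeros: "\<exists>k v. w = replicate k (0::nat) @ v \<and> (v \<noteq> [] \<longrightarrow> hd v \<noteq> 0)"
proof (induction w)
  case (Cons a w)
  then obtain k v where w: "w = replicate k 0 @ v" "v \<noteq> [] \<longrightarrow> hd v \<noteq> 0" by blast
  show ?case
  proof (cases "a = 0")
    case True
    then show ?thesis using w by (intro exI[of _ "Suc k"] exI[of _ v]) simp
  next
    case False
    then show ?thesis by (intro exI[of _ 0] exI[of _ "a # w"]) simp
  qed
qed simp

text \<open>A nonzero leading digit makes the value at least the weight of that position, while
  greediness keeps it below the next weight. Equal values therefore force equal lengths.\<close>

lemma greedy_rep_unique:
  assumes "is_greedy_rep U n v" "is_greedy_rep U n w"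
  shows "v = w"
proof -
  have *: "length v \<le> length w" if "is_greedy_rep U n v" "is_greedy_rep U n w" for v w
  proof (cases v)
    case (Cons a u)
    then have "a > 0" using that by (simp add: is_greedy_rep_iff)
    then have "U (length u) \<le> word_val U v" by (cases a) (simp_all add: Cons)
    also have "\<dots> < U (length w)"
      using that greedy_val_less[of w] by (simp add: is_greedy_rep_iff)
    finally show ?thesis using Cons strict_mono_less[OF strict_mono_U] by simp
  qed simp
  show ?thesis
    using *[OF assms] *[OF assms(2,1)] assms greedy_val_inj[of v w]
    by (simp add: is_greedy_rep_iff)
qed

lemma greedy_rep_eqI: "is_greedy_rep U n w \<Longrightarrow> greedy_rep U n = w"
  unfolding greedy_rep_def using greedy_rep_unique by blast

lemma is_greedy_rep_greedy_rep: "is_greedy_rep U n (greedy_rep U n)"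
proof -
  \<comment> \<open>Strict growth from \<open>U 0 = 1\<close> makes \<open>n\<close> letters enough
    to represent \<open>n\<close>.\<close>
  have "n < U n"
    by (induction n) (use U_less_Suc Suc_lessI le_less_trans in \<open>auto simp: Suc_le_eq intro: less_trans_Suc\<close>)
  then obtain w where w: "greedy U w" "word_val U w = n"
    using greedy_word_exists by blast
  obtain k v where v: "w = replicate k 0 @ v" "v \<noteq> [] \<longrightarrow> hd v \<noteq> 0"
    using strip_zeros by blast
  then have "is_greedy_rep U n v"
    using w greedy_append_zeros word_val_append_zeros by (simp add: is_greedy_rep_iff)
  then show ?thesis using greedy_rep_eqI by simp
qed

lemma numeration_language_eq: "numeration_language U = {w. greedy U w}"
proof (intro equalityI subsetI)
  fix w assume "w \<in> numeration_language U"
  then show "w \<in> {w. greedy U w}"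
    using is_greedy_rep_greedy_rep
    by (auto simp: numeration_language_def greedy_append_zeros is_greedy_rep_iff)
next
  fix w assume w: "w \<in> {w. greedy U w}"
  obtain k v where v: "w = replicate k 0 @ v" "v \<noteq> [] \<longrightarrow> hd v \<noteq> 0"
    using strip_zeros by blast
  then have "greedy_rep U (word_val U v) = v"
    using w greedy_append_zeros by (intro greedy_rep_eqI) (simp add: is_greedy_rep_iff)
  with v(1) have "w = replicate k 0 @ greedy_rep U (word_val U v)" by simp
  then show "w \<in> numeration_language U"
    unfolding numeration_language_def by blast
qed

text \<open>Setting the last digit to 0 does not raise the value of any suffix. With the Bertrand
  condition this makes the language closed under removing the last letter.\<close>

lemma greedy_butlast_0: "greedy U (w @ [c]) \<Longrightarrow> greedy U (w @ [0])"
proof (induction w)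
  case (Cons a w)
  have "word_val U (w @ [0]) \<le> word_val U (w @ [c])" by (induction w) auto
  with Cons show ?case by auto
qed (simp add: U_pos)

section \<open>Languages described by a maximal infinite word\<close>

text \<open>By \<open>val\<close>, the prefixes of \<open>d\<close> attain the largest value
  possible for a greedy word of their length. So a word is greedy iff each suffix is numerically,
  equivalently lexicographically, at most the prefix of that length; the suffixes are treated from
  the shortest up because the comparison needs a greedy tail.\<close>

lemma greedy_eq_subshift_words:
  assumes greedy: "\<And>n. greedy U (pref d n)" and val: "\<And>n. U n = word_val U (pref d n) + 1"
  shows "{w. greedy U w} = subshift_words d"
proof (intro equalityI subsetI)
  fix w assume "w \<in> {w. greedy U w}"
  have "lex_le (pad (drop j w)) d" for j
  proof (rule lex_le_trans[OF lex_le_if_val_le pad_pref_le])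
    show "word_val U (drop j w) \<le> word_val U (pref d (length (drop j w)))"
      using greedy_val_less[OF greedy_drop, of w j] val[of "length (drop j w)"] \<open>w \<in> _\<close> by simp
  qed (use greedy in auto)
  then show "w \<in> subshift_words d" by (simp add: subshift_words_def shift_pad)
next
  fix w assume "w \<in> subshift_words d"
  then have "greedy U w"
  proof (induction w)
    case (Cons a w)
    have g: "greedy U w" using Cons subshift_words_drop[of "a # w" d 1] by simp
    have "lex_le (shift 0 (pad (a # w))) d"
      using Cons.prems unfolding subshift_words_def by blast
    then have "lex_le (pad (a # w)) (pad (pref d (length (a # w))))"
      using pad_le_pref[of "a # w"] by simp
    then have "word_val U (a # w) \<le> word_val U (pref d (length (a # w)))"
      using g by (intro word_val_le_if_lex_le) simp_all
    then show ?case using g val[of "length (a # w)"] by simp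
  qed simp
  then show "w \<in> {w. greedy U w}" by simp
qed

lemma word_val_pref: "word_val U (pref d n) = (\<Sum>j=1..n. d (j - 1) * U (n - j))"
proof -
  have "word_val U (pref d n) = (\<Sum>i<n. d i * U (n - Suc i))"
    by (simp add: word_val_eq_sum)
  also have "\<dots> = (\<Sum>j=1..n. d (j - 1) * U (n - j))"
    by (rule sum.reindex_bij_witness[of _ "\<lambda>j. j - 1" Suc]) auto
  finally show ?thesis .
qed

end

section \<open>Recurrence and alphabet obtained from a maximal infinite word\<close>

locale subshift_numeration = numeration +
  fixes d :: "nat \<Rightarrow> nat"
  assumes language: "numeration_language U = subshift_words d"
    and shift_le: "\<And>i. lex_le (shift i d) d"
begin

lemma greedy_iff: "greedy U w \<longleftrightarrow> w \<in> subshift_words d"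
  using language numeration_language_eq by auto

lemma greedy_pref: "greedy U (pref d n)"
  using pref_in_subshift_words_iff[of d] shift_le greedy_iff by blast

text \<open>The greedy word of value \<open>U n - 1\<close> is lexicographically at most the prefix
  of \<open>d\<close>, so the prefix has at least this value. Being greedy itself, it stays below
  \<open>U n\<close>.\<close>

lemma U_eq_word_val: "U n = word_val U (pref d n) + 1"
proof -
  obtain w where w: "length w = n" "greedy U w" "word_val U w = U n - 1"
    using greedy_word_exists[of "U n - 1" n] U_pos[of n] by auto
  have "lex_le (shift 0 (pad w)) d" using w greedy_iff unfolding subshift_words_def by blast
  then have "lex_le (pad w) (pad (pref d n))" using pad_le_pref[of w d] w by simp
  then have "U n - 1 \<le> word_val U (pref d n)"
    using word_val_le_if_lex_le[of w "pref d n"] w greedy_tl by simp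
  then show ?thesis using greedy_val_less[OF greedy_pref, of n] by simp
qed

lemma U_eq: "U n = (\<Sum>j=1..n. d (j - 1) * U (n - j)) + 1"
  unfolding word_val_pref[symmetric] by (rule U_eq_word_val)

lemma U_1: "U 1 = d 0 + 1"
  using U_eq[of 1] by simp

text \<open>The maximal word of length \<open>n + 1\<close> is \<open>d 0\<close> followed by a
  greedy word, worth less than \<open>U n\<close>. Hence the quotients defining the alphabet are
  largest at index 0.\<close>

lemma U_Suc_le: "U (Suc n) \<le> (d 0 + 1) * U n"
proof -
  define w where "w = map d [1..<Suc n]"
  have w: "pref d (Suc n) = d 0 # w" "length w = n"
    unfolding w_def by (simp_all del: upt_Suc add: upt_conv_Cons)
  then have "word_val U w < U n"
    using greedy_pref[of "Suc n"] greedy_val_less[of w] by simp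
  then show ?thesis using U_eq_word_val[of "Suc n"] w by simp
qed

lemma alphabet_eq: "alphabet U = {0..d 0}"
proof -
  let ?r = "\<lambda>i. \<lceil>real (U (Suc i)) / real (U i)\<rceil>"
  have max: "?r 0 = int (d 0 + 1)"
    by (rule ceiling_unique) (use U_1 in auto)
  have bound: "?r i \<le> int (d 0 + 1)" for i
  proof -
    have "real (U (Suc i)) \<le> real ((d 0 + 1) * U i)" using U_Suc_le of_nat_mono by blast
    then show ?thesis using U_pos[of i] by (simp add: ceiling_le_iff divide_le_eq ring_distribs)
  qed
  have "(SUP i. ?r i) = int (d 0 + 1)"
  proof (rule cSup_eq_maximum)
    show "int (d 0 + 1) \<in> range ?r" using max rangeI[of ?r 0] by simp
  qed (use bound in auto)
  then show ?thesis by (simp add: alphabet_def)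
qed

lemma bertrand_U: "bertrand U"
  unfolding bertrand_def language by (simp add: subshift_words_append_0)

end

section \<open>From the Bertrand condition to a maximal infinite word\<close>

locale positional = numeration +
  assumes bdd: "bdd_above (range (\<lambda>i. real (U (Suc i)) / real (U i)))"
begin

text \<open>Boundedness makes the supremum a true upper bound of the quotients, each of which
  exceeds every digit allowed at its position. The restriction to alphabet words in
  \<open>bertrand\<close> can then be lifted.\<close>

lemma greedy_in_alphabet: "greedy U w \<Longrightarrow> w \<in> lists (alphabet U)"
proof (induction w)
  case (Cons a w)
  let ?r = "\<lambda>i. \<lceil>real (U (Suc i)) / real (U i)\<rceil>" and ?n = "length w"
  obtain B where "\<forall>i. real (U (Suc i)) / real (U i) \<le> B"
    using bdd unfolding bdd_above_def by blast
  then have "bdd_above (range ?r)"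
    by (intro bdd_aboveI[of _ "\<lceil>B\<rceil>"]) (auto intro: ceiling_mono)
  then have "?r ?n \<le> (SUP i. ?r i)" by (intro cSUP_upper) auto
  moreover have "int a < ?r ?n"
  proof -
    have "a * U ?n < U (Suc ?n)" using Cons.prems by simp
    then have "real a * real (U ?n) < real (U (Suc ?n))"
      by (metis of_nat_less_iff of_nat_mult)
    then have "real a < real (U (Suc ?n)) / real (U ?n)"
      using U_pos[of ?n] by (simp add: less_divide_eq)
    then show ?thesis by (simp add: less_ceiling_iff)
  qed
  ultimately have "a \<in> alphabet U" by (simp add: alphabet_def le_nat_iff)
  with Cons show ?case by simp
qed simp

text \<open>Under the Bertrand condition the maximal word of length \<open>n + 1\<close> extends that of length
  \<open>n\<close>, so these words are the prefixes of one infinite word.\<close>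
lemma bertrand_imp_maximal_word:
  assumes "bertrand U"
  obtains d where "subshift_numeration U d"
proof -
  have bert: "greedy U w \<longleftrightarrow> greedy U (w @ [0])" for w
  proof (cases "w \<in> lists (alphabet U)")
    case True
    then show ?thesis using assms unfolding bertrand_def numeration_language_eq by simp
  next
    case False
    then have "w @ [0] \<notin> lists (alphabet U)" by simp
    with False show ?thesis using greedy_in_alphabet by blast
  qed
  have "\<exists>w. length w = n \<and> greedy U w \<and> word_val U w = U n - 1" for n
    using greedy_word_exists[of "U n - 1" n] U_pos[of n] by simp
  then obtain M where M: "\<And>n. length (M n) = n" "\<And>n. greedy U (M n)"
    "\<And>n. word_val U (M n) = U n - 1" by metis
  have maximal: "lex_le (pad w) (pad (M n))" if "length w = n" "greedy U w" for w n
    using that M greedy_val_less[of w] by (intro lex_le_if_val_le) auto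
  \<comment> \<open>Write \<open>M (Suc n)\<close> as \<open>v @ [c]\<close>. Replacing
    \<open>c\<close> by 0 and then removing it shows that \<open>v\<close> is greedy, hence at most
    \<open>M n\<close>. Conversely \<open>M n @ [0]\<close> is greedy, hence at most
    \<open>v @ [c]\<close>, and truncation gives that \<open>M n\<close> is at most
    \<open>v\<close>.\<close>
  have butlast_M: "butlast (M (Suc n)) = M n" for n
  proof -
    obtain v c where v: "M (Suc n) = v @ [c]" by (metis M(1) length_Suc_conv_rev)
    then have len: "length v = n" using M(1)[of "Suc n"] by simp
    have "greedy U v" using M(2)[of "Suc n"] v greedy_butlast_0 bert by metis
    then have le: "lex_le (pad v) (pad (M n))" using maximal len by blast
    have "lex_le (pad (M n @ [0])) (pad (M (Suc n)))"
      using bert M by (intro maximal) simp_all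
    then have "lex_le (pad (M n)) (pad (M (Suc n)))" by simp
    then have "lex_le (pad (M n)) (pad (pref (pad (M (Suc n))) n))"
      using pad_le_pref[of "M n" "pad (M (Suc n))"] M(1) by simp
    moreover have "pref (pad (M (Suc n))) n = v"
      using len by (auto simp: v pad_def nth_append intro: nth_equalityI)
    ultimately have "lex_le (pad (M n)) (pad v)" by simp
    with le have "pad v = pad (M n)" using lex_le_antisym by blast
    then show ?thesis using pad_inj len M(1) v by simp
  qed
  define d where "d n = M (Suc n) ! n" for n
  have pref_d: "pref d n = M n" for n
  proof (induction n)
    case 0
    then show ?case using M(1)[of 0] by simp
  next
    case (Suc n)
    have "M (Suc n) = butlast (M (Suc n)) @ [last (M (Suc n))]"
      using M(1)[of "Suc n"] by (metis append_butlast_last_id list.size(3) nat.distinct(1))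
    also have "last (M (Suc n)) = d n"
      using M(1)[of "Suc n"] by (metis d_def diff_Suc_1 last_conv_nth list.size(3) nat.distinct(1))
    finally show ?case using Suc butlast_M by simp
  qed
  have eq: "{w. greedy U w} = subshift_words d"
    using M U_pos by (intro greedy_eq_subshift_words) (auto simp: pref_d Suc_leI)
  have "\<forall>n. pref d n \<in> subshift_words d"
    using eq pref_d M(2) by auto
  then have "\<forall>i. lex_le (shift i d) d"
    by (rule pref_in_subshift_words_iff[THEN iffD1])
  then have "subshift_numeration U d"
    using eq by unfold_locales (simp_all add: numeration_language_eq)
  then show thesis by (rule that)
qed

end

section \<open>A renewal theorem\<close>

text \<open>Dominated convergence with majorant \<open>p i * C\<close>; every fixed index
  \<open>i\<close> eventually lies below the cutoff \<open>m n\<close>.\<close>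

lemma convolution_tendsto:
  fixes p :: "nat \<Rightarrow> real" and a :: "nat \<Rightarrow> nat \<Rightarrow> real"
  assumes p: "summable p" "\<And>i. 0 \<le> p i"
    and bound: "\<And>i n. \<bar>a i n\<bar> \<le> C" and m: "filterlim m at_top sequentially"
    and lim: "\<And>i. (\<lambda>n. a i n) \<longlonglongrightarrow> l"
  shows "(\<lambda>n. \<Sum>i<m n. p i * a i n) \<longlonglongrightarrow> suminf p * l"
proof -
  define b where "b i n = (if i < m n then p i * a i n else 0)" for i n
  have C: "0 \<le> C" using bound[of 0 0] by linarith
  have "(\<lambda>n. \<Sum>i. b i n) \<longlonglongrightarrow> (\<Sum>i. p i * l)"
  proof (rule tannerys_theorem[THEN conjunct2, THEN conjunct2])
    show "summable (\<lambda>i. p i * C)" using p by (intro summable_mult2)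
    show "(\<lambda>n. b i n) \<longlonglongrightarrow> p i * l" for i
    proof (rule Lim_transform_eventually)
      show "(\<lambda>n. p i * a i n) \<longlonglongrightarrow> p i * l" using lim by (intro tendsto_intros)
      show "\<forall>\<^sub>F n in sequentially. p i * a i n = b i n"
        using m[unfolded filterlim_at_top, rule_format, of "Suc i"]
        by eventually_elim (simp add: b_def)
    qed
    show "\<forall>\<^sub>F (i, n) in at_top \<times>\<^sub>F sequentially. norm (b i n) \<le> p i * C"
      using p bound C by (intro always_eventually)
        (auto simp: b_def abs_mult intro!: mult_left_mono mult_nonneg_nonneg)
  qed simp
  moreover have "(\<Sum>i. b i n) = (\<Sum>i<m n. p i * a i n)" for n
    by (subst suminf_finite[of "{..<m n}"]) (auto simp: b_def)
  moreover have "(\<Sum>i. p i * l) = suminf p * l"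
    using p by (simp add: suminf_mult2)
  ultimately show ?thesis by simp
qed

text \<open>Here \<open>l\<close> is the limit superior. That \<open>u\<close> overshoots
  \<open>l\<close> only by a null sequence is stated with \<open>max\<close>, so that the overshoot
  can be carried through convolutions.\<close>

lemma bounded_limsup_subseq:
  fixes u :: "nat \<Rightarrow> real"
  assumes "\<And>n. \<bar>u n\<bar> \<le> C"
  obtains r l where "strict_mono r" "(\<lambda>k. u (r k)) \<longlonglongrightarrow> l"
    "(\<lambda>n. max (u n - l) 0) \<longlonglongrightarrow> 0" "\<bar>l\<bar> \<le> C"
proof -
  define L where "L = limsup (\<lambda>n. ereal (u n))"
  have "L \<le> ereal C" unfolding L_def using assms
    by (intro Limsup_bounded always_eventually) (auto simp: abs_le_iff)
  moreover have "ereal (- C) \<le> L" unfolding L_def using assms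
    by (intro le_Limsup always_eventually) (auto simp: abs_le_iff minus_le_iff)
  ultimately obtain l where l: "L = ereal l" by (cases L) auto
  obtain r where r: "strict_mono r" "((\<lambda>n. ereal (u n)) \<circ> r) \<longlonglongrightarrow> L"
    using limsup_subseq_lim unfolding L_def by blast
  have "(\<lambda>n. max (u n - l) 0) \<longlonglongrightarrow> 0"
  proof (rule order_tendstoI)
    fix e :: real assume "0 < e"
    then have "L < ereal (l + e)" by (simp add: l)
    then have "\<forall>\<^sub>F n in sequentially. ereal (u n) < ereal (l + e)"
      unfolding L_def by (rule Limsup_lessD)
    then show "\<forall>\<^sub>F n in sequentially. max (u n - l) 0 < e"
      by eventually_elim (use \<open>0 < e\<close> in simp)
  qed (auto intro!: always_eventually simp: less_max_iff_disj)
  moreover have "(\<lambda>k. u (r k)) \<longlonglongrightarrow> l" using r(2) by (simp add: l o_def)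
  moreover have "\<bar>l\<bar> \<le> C"
    using \<open>L \<le> ereal C\<close> \<open>ereal (- C) \<le> L\<close> by (simp add: l abs_le_iff)
  ultimately show thesis using that r(1) by blast
qed

text \<open>\<open>p\<close> is the step distribution, with \<open>p_0\<close> securing
  aperiodicity. \<open>q\<close> supplies a second convolution with the solution, known to converge,
  which pins down the limit; it will be the sequence of tail sums of \<open>p\<close>.\<close>

locale renewal =
  fixes p q :: "nat \<Rightarrow> real"
  assumes p_nonneg: "\<And>i. 0 \<le> p i" and p_sums: "p sums 1" and p_0: "0 < p 0"
    and q_nonneg: "\<And>i. 0 \<le> q i" and q_summable: "summable q" and q_pos: "0 < suminf q"
begin

text \<open>Along a subsequence on which \<open>u\<close> tends to its upper limit \<open>l\<close>, the recurrence forces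
  every fixed shift of \<open>u\<close> to tend to \<open>l\<close> as well, since \<open>u n\<close> is almost an average of earlier
  values in which \<open>u (n - 1)\<close> has weight \<open>p 0 > 0\<close>.\<close>
lemma limsup_le:
  fixes u e c :: "nat \<Rightarrow> real"
  assumes u: "\<And>n. \<bar>u n\<bar> \<le> C"
    and rec: "\<And>n. u n = (\<Sum>i<n. p i * u (n - Suc i)) + e n" and e: "e \<longlonglongrightarrow> 0"
    and conv: "(\<lambda>n. \<Sum>i<Suc n. q i * u (n - i)) \<longlonglongrightarrow> c0"
    and eps: "0 < \<epsilon>"
  shows "\<forall>\<^sub>F n in sequentially. u n < c0 / suminf q + \<epsilon>"
proof -
  obtain r l where r: "strict_mono r" and lim: "(\<lambda>k. u (r k)) \<longlonglongrightarrow> l"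
    and b: "(\<lambda>n. max (u n - l) 0) \<longlonglongrightarrow> 0" and l: "\<bar>l\<bar> \<le> C"
    using bounded_limsup_subseq[of u C] u by blast
  define b where "b n = max (u n - l) 0" for n
  have b0: "b \<longlonglongrightarrow> 0" using b by (simp add: b_def[abs_def])
  have b_bound: "\<bar>b n\<bar> \<le> 2 * C" for n using u[of n] l by (auto simp: b_def)
  \<comment> \<open>The gap between \<open>u\<close> and its vanishing-overshoot upper bound
    \<open>l + b\<close>.\<close>
  define D where "D n = l + b n - u n" for n
  have D_nonneg: "0 \<le> D n" for n by (auto simp: D_def b_def)
  \<comment> \<open>By the recurrence, \<open>E n\<close> is the \<open>p\<close>-weighted sum of
    all earlier gaps; it therefore dominates the single term with weight \<open>p 0\<close>.\<close>
  define E where "E n = l * (\<Sum>i<n. p i) + (\<Sum>i<n. p i * b (n - Suc i)) - u n + e n" for n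
  have D_le: "p 0 * D n \<le> E (Suc n)" for n
  proof -
    have "p 0 * D (Suc n - Suc 0) \<le> (\<Sum>i<Suc n. p i * D (Suc n - Suc i))"
      using D_nonneg p_nonneg by (intro member_le_sum) auto
    also have "\<dots> = l * (\<Sum>i<Suc n. p i) + (\<Sum>i<Suc n. p i * b (Suc n - Suc i))
        - (\<Sum>i<Suc n. p i * u (Suc n - Suc i))"
      unfolding D_def sum_distrib_left sum.distrib[symmetric] sum_subtractf[symmetric]
      by (intro sum.cong refl) (simp add: algebra_simps)
    also have "\<dots> = E (Suc n)" using rec[of "Suc n"] by (simp only: E_def)
    finally show ?thesis by simp
  qed
  have conv_b: "(\<lambda>n. \<Sum>i<n. p i * b (n - Suc i)) \<longlonglongrightarrow> suminf p * 0"
  proof (rule convolution_tendsto)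
    show "(\<lambda>n. b (n - Suc i)) \<longlonglongrightarrow> 0" for i
      by (rule filterlim_compose[OF b0 filterlim_minus_const_nat_at_top])
  qed (use p_sums p_nonneg b_bound in \<open>auto simp: sums_iff filterlim_ident\<close>)
  \<comment> \<open>If the gap vanishes along \<open>s\<close>, then \<open>u (s k)\<close> tends to
    \<open>l\<close>, so \<open>E (s k)\<close> tends to 0 and forces the gap one index earlier to
    vanish.\<close>
  have step: "(\<lambda>k. D (s k - 1)) \<longlonglongrightarrow> 0"
    if "filterlim s at_top sequentially" "(\<lambda>k. D (s k)) \<longlonglongrightarrow> 0" for s
  proof -
    have "(\<lambda>k. b (s k) - D (s k)) \<longlonglongrightarrow> 0 - 0"
      using that filterlim_compose[OF b0 that(1)] by (intro tendsto_diff)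
    then have "(\<lambda>k. (b (s k) - D (s k)) + l) \<longlonglongrightarrow> 0 + l"
      by (intro tendsto_intros) simp
    then have us: "(\<lambda>k. u (s k)) \<longlonglongrightarrow> l" by (simp add: D_def)
    have "(\<lambda>n. \<Sum>i<n. p i) \<longlonglongrightarrow> 1" using p_sums by (simp add: sums_def)
    note * = this conv_b e
    have "(\<lambda>k. E (s k)) \<longlonglongrightarrow> l * 1 + suminf p * 0 - l + 0"
      unfolding E_def using us *[THEN filterlim_compose, OF that(1)]
      by (intro tendsto_intros)
    then have "(\<lambda>k. E (s k) / p 0) \<longlonglongrightarrow> 0 / p 0"
      using p_0 by (intro tendsto_divide) auto
    then have E0: "(\<lambda>k. E (s k) / p 0) \<longlonglongrightarrow> 0" by simp
    show ?thesis
    proof (rule tendsto_sandwich[OF _ _ tendsto_const E0])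
      show "\<forall>\<^sub>F k in sequentially. D (s k - 1) \<le> E (s k) / p 0"
        using that(1)[unfolded filterlim_at_top, rule_format, of 1]
      proof eventually_elim
        case (elim k)
        then show ?case using D_le[of "s k - 1"] p_0 by (simp add: le_divide_eq mult.commute)
      qed
    qed (simp add: D_nonneg)
  qed
  have r_top: "filterlim (\<lambda>k. r k - j) at_top sequentially" for j
    by (rule filterlim_compose[OF filterlim_minus_const_nat_at_top filterlim_subseq[OF r]])
  have D_lim: "(\<lambda>k. D (r k - j)) \<longlonglongrightarrow> 0" for j
  proof (induction j)
    case 0
    have "(\<lambda>k. l + b (r k) - u (r k)) \<longlonglongrightarrow> l + 0 - l"
      using lim filterlim_compose[OF b0 filterlim_subseq[OF r]] by (intro tendsto_intros)
    then show ?case by (simp add: D_def)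
  next
    case (Suc j)
    show ?case using step[OF r_top Suc] by simp
  qed
  have u_lim: "(\<lambda>k. u (r k - j)) \<longlonglongrightarrow> l" for j
  proof -
    have "(\<lambda>k. l + b (r k - j) - D (r k - j)) \<longlonglongrightarrow> l + 0 - 0"
      using D_lim filterlim_compose[OF b0 r_top] by (intro tendsto_intros)
    then show ?thesis by (simp add: D_def)
  qed
  \<comment> \<open>With all fixed shifts tending to \<open>l\<close>, the convolution with
    \<open>q\<close> has two expressions for its limit along \<open>r\<close>, which determines
    \<open>l\<close>.\<close>
  have "(\<lambda>k. \<Sum>i<Suc (r k). q i * u (r k - i)) \<longlonglongrightarrow> suminf q * l"
    using q_summable q_nonneg u u_lim
      filterlim_compose[OF filterlim_Suc filterlim_subseq[OF r]]
    by (intro convolution_tendsto) auto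
  moreover have "(\<lambda>k. \<Sum>i<Suc (r k). q i * u (r k - i)) \<longlonglongrightarrow> c0"
    by (rule filterlim_compose[OF conv filterlim_subseq[OF r]])
  ultimately have "suminf q * l = c0" by (rule LIMSEQ_unique)
  then have "l = c0 / suminf q" using q_pos by (simp add: field_simps)
  moreover have "\<forall>\<^sub>F n in sequentially. b n < \<epsilon>" using b0 eps by (rule order_tendstoD)
  ultimately show ?thesis
    by (auto elim!: eventually_mono simp: b_def)
qed

text \<open>\<open>limsup_le\<close> applied to \<open>u\<close> bounds the upper limit; applied to
  \<open>-u\<close>, it bounds the lower limit by the same value.\<close>

lemma renewal_limit:
  fixes u e :: "nat \<Rightarrow> real"
  assumes u: "\<And>n. \<bar>u n\<bar> \<le> C"
    and rec: "\<And>n. u n = (\<Sum>i<n. p i * u (n - Suc i)) + e n" and e: "e \<longlonglongrightarrow> 0"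
    and conv: "(\<lambda>n. \<Sum>i<Suc n. q i * u (n - i)) \<longlonglongrightarrow> c"
  shows "u \<longlonglongrightarrow> c / suminf q"
proof (rule LIMSEQ_I)
  fix \<epsilon> :: real assume \<epsilon>: "0 < \<epsilon>"
  have 1: "\<forall>\<^sub>F n in sequentially. u n < c / suminf q + \<epsilon>"
    by (rule limsup_le[OF u rec e conv \<epsilon>])
  have "\<forall>\<^sub>F n in sequentially. - u n < - c / suminf q + \<epsilon>"
  proof (rule limsup_le[where u = "\<lambda>n. - u n" and e = "\<lambda>n. - e n", OF _ _ _ _ \<epsilon>])
    show "- u n = (\<Sum>i<n. p i * - u (n - Suc i)) + - e n" for n
      using rec[of n] by (simp add: sum_negf)
    show "(\<lambda>n. - e n) \<longlonglongrightarrow> 0" using tendsto_minus[OF e] by simp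
    show "(\<lambda>n. \<Sum>i<Suc n. q i * - u (n - i)) \<longlonglongrightarrow> - c"
      using tendsto_minus[OF conv] by (simp add: sum_negf)
  qed (use u in simp)
  with 1 have "\<forall>\<^sub>F n in sequentially. norm (u n - c / suminf q) < \<epsilon>"
    by eventually_elim (auto simp: abs_less_iff)
  then show "\<exists>N. \<forall>n\<ge>N. norm (u n - c / suminf q) < \<epsilon>"
    by (simp add: eventually_sequentially)
qed

end

section \<open>Quasi-greedy and greedy expansions of 1\<close>

text \<open>While the digits agree, the difference of the remainders is only multiplied by \<beta>,
  so their order persists up to the first differing digit, where \<open>digits\<close> excludes a
  larger \<open>a\<close>.\<close>

lemma lex_le_digits:
  fixes x y :: "nat \<Rightarrow> real" and a b :: "nat \<Rightarrow> nat"
  assumes "0 \<le> \<beta>" "x 0 \<le> y 0"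
    and x: "\<And>i. x (Suc i) = \<beta> * x i - real (a i)"
    and y: "\<And>i. y (Suc i) = \<beta> * y i - real (b i)"
    and digits: "\<And>i. x i \<le> y i \<Longrightarrow> a i \<le> b i"
  shows "lex_le a b"
proof (rule ccontr)
  assume "\<not> lex_le a b"
  then obtain k where k: "b k < a k" "\<forall>j<k. b j = a j"
    unfolding not_lex_le_iff less_fun_def by blast
  have "j \<le> k \<Longrightarrow> x j \<le> y j" for j
  proof (induction j)
    case (Suc j)
    then show ?case using k(2) x y mult_left_mono[of "x j" "y j" \<beta>] assms(1) by simp
  qed (use assms in simp)
  then show False using digits[of k] k(1) by simp
qed

text \<open>Remainders in the closed interval allow for both the greedy expansion, whose remainders are
  below 1 after the first one, and the quasi-greedy expansion, whose remainders are positive.\<close>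
locale unit_expansion =
  fixes \<beta> :: real and d :: "nat \<Rightarrow> nat" and x :: "nat \<Rightarrow> real"
  assumes beta: "1 < \<beta>" and x_0: "x 0 = 1" and x_nonneg: "\<And>i. 0 \<le> x i" and x_le_1: "\<And>i. x i \<le> 1"
    and x_Suc: "\<And>i. x (Suc i) = \<beta> * x i - real (d i)"

text \<open>The left limits at 1 of the remainders of \<open>x\<close>. The floor of a quantity
  approaching its limit strictly from below is the ceiling of the limit minus 1, which keeps the
  limits in (0,1].\<close>

primrec quasi_remainder :: "real \<Rightarrow> nat \<Rightarrow> real" where
  "quasi_remainder \<beta> 0 = 1"
| "quasi_remainder \<beta> (Suc i) = \<beta> * quasi_remainder \<beta> i - of_int (\<lceil>\<beta> * quasi_remainder \<beta> i\<rceil> - 1)"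

lemma quasi_remainder_bounds: "0 < quasi_remainder \<beta> i \<and> quasi_remainder \<beta> i \<le> 1"
  by (cases i) (simp, simp, linarith)

text \<open>The induction carries \<open>at_left\<close> instead of mere convergence: strict
  approach from below is what makes the next floor eventually constant.\<close>

lemma beta_remainder_at_left_quasi:
  assumes "\<beta> > 1"
  shows "filterlim (\<lambda>x. \<beta> * beta_remainder \<beta> x i) (at_left (\<beta> * quasi_remainder \<beta> i)) (at_left 1)"
proof -
  have scale: "filterlim (\<lambda>x. \<beta> * beta_remainder \<beta> x i) (at_left (\<beta> * quasi_remainder \<beta> i)) (at_left 1)"
    if "filterlim (\<lambda>x. beta_remainder \<beta> x i) (at_left (quasi_remainder \<beta> i)) (at_left 1)" for i
    using that assms unfolding filterlim_at
    by (auto intro!: tendsto_mult elim: eventually_mono)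
  have "filterlim (\<lambda>x. beta_remainder \<beta> x i) (at_left (quasi_remainder \<beta> i)) (at_left 1)"
  proof (induction i)
    case 0
    show ?case by (simp add: filterlim_ident)
  next
    case (Suc i)
    let ?c = "\<lceil>\<beta> * quasi_remainder \<beta> i\<rceil> - 1"
    have "filterlim (\<lambda>x. \<beta> * beta_remainder \<beta> x i - of_int ?c)
        (at_left (\<beta> * quasi_remainder \<beta> i - of_int ?c)) (at_left 1)"
      using scale[OF Suc] unfolding filterlim_at
      by (auto intro!: tendsto_diff elim: eventually_mono)
    moreover have "\<forall>\<^sub>F x in at_left 1.
        \<beta> * beta_remainder \<beta> x i - of_int ?c = beta_remainder \<beta> x (Suc i)"
      using floor_at_left[OF scale[OF Suc]] by (rule eventually_mono) simp
    ultimately show ?case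
      unfolding quasi_remainder.simps by (simp only: filterlim_cong[OF refl refl])
  qed
  then show ?thesis by (rule scale)
qed

lemma quasi_greedy_eq:
  assumes "\<beta> > 1"
  shows "quasi_greedy \<beta> i = nat (\<lceil>\<beta> * quasi_remainder \<beta> i\<rceil> - 1)"
proof -
  have "(beta_expansion \<beta> \<longlongrightarrow> quasi_greedy \<beta>) (at_left 1)"
    unfolding quasi_greedy_def by (rule theI'[OF quasi_greedy_unique[OF assms]])
  then have "((\<lambda>x. beta_expansion \<beta> x i) \<longlongrightarrow> quasi_greedy \<beta> i) (at_left 1)"
    by (simp add: tendsto_coordinatewise_iff)
  moreover have "\<forall>\<^sub>F x in at_left 1. beta_expansion \<beta> x i = nat (\<lceil>\<beta> * quasi_remainder \<beta> i\<rceil> - 1)"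
    using floor_at_left[OF beta_remainder_at_left_quasi[OF assms, of i]]
    by (rule eventually_mono) (simp add: beta_expansion_def)
  then have "((\<lambda>x. beta_expansion \<beta> x i) \<longlongrightarrow> nat (\<lceil>\<beta> * quasi_remainder \<beta> i\<rceil> - 1)) (at_left 1)"
    by (rule tendsto_eventually)
  ultimately show ?thesis by (rule tendsto_unique[OF trivial_limit_at_left_real])
qed

lemma real_quasi_greedy:
  assumes "\<beta> > 1"
  shows "real (quasi_greedy \<beta> i) = of_int (\<lceil>\<beta> * quasi_remainder \<beta> i\<rceil> - 1)"
proof -
  have "0 < \<beta> * quasi_remainder \<beta> i" using assms quasi_remainder_bounds[of \<beta> i] by simp
  then have "1 \<le> \<lceil>\<beta> * quasi_remainder \<beta> i\<rceil>" by linarith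
  then show ?thesis using quasi_greedy_eq[OF assms] by simp
qed

lemma unit_expansion_quasi_greedy:
  assumes "\<beta> > 1"
  shows "unit_expansion \<beta> (quasi_greedy \<beta>) (quasi_remainder \<beta>)"
  using assms quasi_remainder_bounds[of \<beta>] real_quasi_greedy[OF assms]
  by unfold_locales (auto simp: less_imp_le)

lemma quasi_greedy_0: "\<beta> > 1 \<Longrightarrow> quasi_greedy \<beta> 0 = nat (\<lceil>\<beta>\<rceil> - 1)"
  by (simp add: quasi_greedy_eq)

text \<open>Every remainder is at most 1, the initial one, and the digit is a monotone function of
  the remainder.\<close>

lemma quasi_greedy_shift_le:
  assumes "\<beta> > 1"
  shows "lex_le (shift i (quasi_greedy \<beta>)) (quasi_greedy \<beta>)"
proof (rule lex_le_digits[where \<beta> = \<beta> and x = "\<lambda>j. quasi_remainder \<beta> (i + j)" and y = "quasi_remainder \<beta>"])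
  show "shift i (quasi_greedy \<beta>) j \<le> quasi_greedy \<beta> j"
    if "quasi_remainder \<beta> (i + j) \<le> quasi_remainder \<beta> j" for j
    using that assms
    by (auto simp: shift_def quasi_greedy_eq intro!: nat_mono diff_right_mono ceiling_mono)
qed (use assms quasi_remainder_bounds[of \<beta>] real_quasi_greedy[OF assms] in \<open>simp_all add: shift_def\<close>)

section \<open>The greedy expansion of 1 and the factor languages of \<open>S\<close> and
  \<open>S'\<close>\<close>

lemma beta_remainder_bounds: "0 \<le> beta_remainder \<beta> 1 i \<and> beta_remainder \<beta> 1 i \<le> 1"
  by (cases i) (simp, simp, linarith)

lemma real_beta_expansion:
  assumes "\<beta> > 1"
  shows "real (beta_expansion \<beta> 1 i) = of_int \<lfloor>\<beta> * beta_remainder \<beta> 1 i\<rfloor>"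
  using assms beta_remainder_bounds[of \<beta> i] by (simp add: beta_expansion_def)

lemma unit_expansion_beta_expansion:
  assumes "\<beta> > 1"
  shows "unit_expansion \<beta> (beta_expansion \<beta> 1) (beta_remainder \<beta> 1)"
  using assms beta_remainder_bounds[of \<beta>] real_beta_expansion[OF assms]
  by unfold_locales auto

lemma beta_expansion_0: "beta_expansion \<beta> 1 0 = nat \<lfloor>\<beta>\<rfloor>"
  by (simp add: beta_expansion_def)

lemma beta_expansion_shift_le:
  assumes "\<beta> > 1"
  shows "lex_le (shift i (beta_expansion \<beta> 1)) (beta_expansion \<beta> 1)"
proof (rule lex_le_digits[where \<beta> = \<beta> and x = "\<lambda>j. beta_remainder \<beta> 1 (i + j)" and y = "beta_remainder \<beta> 1"])
  show "shift i (beta_expansion \<beta> 1) j \<le> beta_expansion \<beta> 1 j"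
    if "beta_remainder \<beta> 1 (i + j) \<le> beta_remainder \<beta> 1 j" for j
    using that assms
    by (auto simp: shift_def beta_expansion_def intro!: nat_mono floor_mono)
qed (use assms beta_remainder_bounds[of \<beta>] real_beta_expansion[OF assms] in \<open>simp_all add: shift_def\<close>)

lemma Fac_S: "\<beta> > 1 \<Longrightarrow> Fac (S \<beta>) = subshift_words (quasi_greedy \<beta>)"
  unfolding Fac_subshift[symmetric] S_def
  by (intro arg_cong[of _ _ Fac]) (use subshift_range quasi_greedy_0 in fastforce)

lemma Fac_S': "Fac (S' \<beta>) = subshift_words (beta_expansion \<beta> 1)"
  unfolding Fac_subshift[symmetric] S'_def
  by (intro arg_cong[of _ _ Fac]) (use subshift_range beta_expansion_0 in fastforce)

section \<open>Parry's characterisation of the expansions of 1\<close>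

text \<open>The intermediate value theorem for the power series \<open>g\<close>. Convergence at 1
  may fail, so a polynomial truncation \<open>P\<close> first supplies a point \<open>t < 1\<close>
  with \<open>g t > 1\<close>.\<close>

lemma exists_root:
  fixes d :: "nat \<Rightarrow> nat"
  assumes bound: "\<And>i. d i \<le> d 0" and "1 \<le> d 0" and "d \<noteq> (\<lambda>i. if i = 0 then 1 else 0)"
  obtains z where "0 < z" "z < 1" "z * (\<Sum>i. real (d i) * z ^ i) = 1"
proof -
  \<comment> \<open>This is where the word 1000... is excluded: any other word starting with 1 has a
    second nonzero letter.\<close>
  obtain k where k: "2 \<le> (\<Sum>i<Suc k. d i)"
  proof (cases "2 \<le> d 0")
    case True
    then show thesis using that[of 0] by simp
  next
    case False
    then have "d 0 = 1" using assms by simp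
    obtain k where "d k \<noteq> (if k = 0 then 1 else 0)" using assms(3) by blast
    then have "k > 0" "d k > 0" using \<open>d 0 = 1\<close> by (cases "k = 0"; simp)+
    then have "(\<Sum>i\<in>{0, k}. d i) \<le> (\<Sum>i<Suc k. d i)" by (intro sum_mono2) auto
    then show thesis using that[of k] \<open>d 0 = 1\<close> \<open>k > 0\<close> \<open>d k > 0\<close> by simp
  qed
  define P where "P z = z * (\<Sum>i<Suc k. real (d i) * z ^ i)" for z :: real
  define g where "g z = z * (\<Sum>i. real (d i) * z ^ i)" for z :: real
  have "P 1 = real (\<Sum>i<Suc k. d i)" by (simp add: P_def)
  then have P1: "2 \<le> P 1" using k by linarith
  \<comment> \<open>The level 3/2 is above the target 1 and below \<open>P 1\<close>, so it is
    reached strictly before 1.\<close>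
  have "\<exists>z. 0 \<le> z \<and> z \<le> 1 \<and> P z = 3 / 2"
    using P1 by (intro IVT') (auto simp: P_def intro!: continuous_intros)
  then obtain t where t: "0 \<le> t" "t \<le> 1" "P t = 3 / 2" by blast
  then have "t < 1" using P1 by (cases "t = 1") auto
  have summ: "summable (\<lambda>i. real (d i) * z ^ i)" if "0 \<le> z" "z < 1" for z :: real
  proof (rule summable_comparison_test')
    show "summable (\<lambda>i. real (d 0) * z ^ i)" using that by (intro summable_mult summable_geometric) simp
    show "norm (real (d n) * z ^ n) \<le> real (d 0) * z ^ n" for n
      using bound[of n] that by (auto simp: abs_mult intro!: mult_right_mono)
  qed
  have "P t \<le> g t" unfolding P_def g_def
    using t(1) \<open>t < 1\<close> by (intro mult_left_mono sum_le_suminf summ) auto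
  moreover have "continuous_on {0..t} g"
  proof (rule continuous_at_imp_continuous_on, rule ballI)
    fix z assume "z \<in> {0..t}"
    then have "isCont (\<lambda>z. \<Sum>i. real (d i) * z ^ i) z"
      using \<open>t < 1\<close> by (intro isCont_powser[where K = "(t + 1) / 2"] summ) auto
    then show "isCont g z" unfolding g_def by (intro continuous_intros)
  qed
  ultimately have "\<exists>z. 0 \<le> z \<and> z \<le> t \<and> g z = 1"
    using t by (intro IVT') (auto simp: g_def)
  then obtain z where "0 \<le> z" "z \<le> t" "g z = 1" by blast
  moreover from this have "z \<noteq> 0" by (auto simp: g_def)
  ultimately show thesis using that[of z] \<open>t < 1\<close> by (simp add: g_def)
qed

text \<open>Take \<beta> as the inverse of the root, so that \<open>d\<close> has value 1 in base
  \<beta>. Maximality among its shifts confines the values of the shifts to [0,1], and these values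
  are then the remainders of one of the two expansions.\<close>

lemma shift_maximal_expansion:
  fixes d :: "nat \<Rightarrow> nat"
  assumes shift_le: "\<And>i. lex_le (shift i d) d" and "1 \<le> d 0"
    and "d \<noteq> (\<lambda>i. if i = 0 then 1 else 0)"
  obtains \<beta> where "1 < \<beta>" "d = quasi_greedy \<beta> \<or> d = beta_expansion \<beta> 1"
proof -
  have bound: "d i \<le> d 0" for i
    using lex_le_head[OF shift_le[of i]] by (simp add: shift_def)
  obtain z where z: "0 < z" "z < 1" "z * (\<Sum>i. real (d i) * z ^ i) = 1"
    using exists_root[of d] bound assms by blast
  define \<beta> where "\<beta> = 1 / z"
  have beta: "1 < \<beta>" "0 < \<beta>" using z by (simp_all add: \<beta>_def)
  \<comment> \<open>The value in base \<beta> of \<open>d\<close> shifted by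
    \<open>n\<close>.\<close>
  define x where "x n = z * (\<Sum>i. real (d (n + i)) * z ^ i)" for n
  have summ: "summable (\<lambda>i. real (d (n + i)) * z ^ i)" for n
  proof (rule summable_comparison_test')
    show "summable (\<lambda>i. real (d 0) * z ^ i)" using z by (intro summable_mult summable_geometric) simp
    show "norm (real (d (n + i)) * z ^ i) \<le> real (d 0) * z ^ i" for i
      using bound[of "n + i"] z by (auto simp: abs_mult intro!: mult_right_mono)
  qed
  have x_0: "x 0 = 1" using z by (simp add: x_def)
  have x_nonneg: "0 \<le> x n" for n
    unfolding x_def using z summ by (intro mult_nonneg_nonneg suminf_nonneg) auto
  have x_Suc: "x (Suc n) = \<beta> * x n - real (d n)" for n
  proof -
    have "(\<Sum>i. real (d (Suc n + i)) * z ^ i * z) = (\<Sum>i. real (d (n + i)) * z ^ i) - real (d n)"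
      using suminf_split_head[OF summ[of n]] by (simp add: mult.assoc mult.commute[of z])
    then show ?thesis
      using z suminf_mult2[OF summ[of "Suc n"], of z] by (simp add: x_def \<beta>_def mult.commute)
  qed
  have agree: "x (n + k) - x k = \<beta> ^ k * (x n - 1)" if "\<forall>j<k. shift n d j = d j" for n k
    using that
  proof (induction k)
    case (Suc k)
    have "x (n + Suc k) - x (Suc k) = \<beta> * (x (n + k) - x k) - (real (shift n d k) - real (d k))"
      by (simp add: x_Suc shift_def algebra_simps)
    then show ?case using Suc by (simp add: mult.assoc)
  qed (simp add: x_0)
  text \<open>If the shift by \<open>n\<close> is smaller, an excess of \<open>x n\<close> over 1 is amplified later on.\<close>
  have smaller: "\<exists>k. x (n + Suc k) - 1 \<ge> \<beta> ^ Suc k * (x n - 1) + x (Suc k)"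
    if neq: "shift n d \<noteq> d" for n
  proof -
    obtain k where k: "shift n d k < d k" "\<forall>j<k. shift n d j = d j"
      using shift_le[of n] neq unfolding lex_le_def less_fun_def by blast
    have "real (d (n + k)) + 1 \<le> real (d k)" using k(1) by (simp add: shift_def)
    moreover have "x (n + Suc k) - x (Suc k) = \<beta> * (x (n + k) - x k) - (real (d (n + k)) - real (d k))"
      by (simp add: x_Suc algebra_simps)
    ultimately show ?thesis using agree[OF k(2)] by (intro exI[of _ k]) simp
  qed
  have same: "x n = 1" if "shift n d = d" for n
    using that x_0 by (simp add: x_def shift_def fun_eq_iff)
  \<comment> \<open>An excess \<delta> over 1 would be multiplied by at least \<beta> again and
    again, against the common bound on all \<open>x m\<close>.\<close>
  have x_le_1: "x n \<le> 1" for n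
  proof (rule ccontr)
    assume "\<not> x n \<le> 1"
    define \<delta> where "\<delta> = x n - 1"
    have "\<delta> > 0" using \<open>\<not> x n \<le> 1\<close> by (simp add: \<delta>_def)
    have grow: "\<exists>m. x m - 1 \<ge> \<beta> ^ j * \<delta>" for j
    proof (induction j)
      case 0
      then show ?case by (auto simp: \<delta>_def)
    next
      case (Suc j)
      then obtain m where m: "x m - 1 \<ge> \<beta> ^ j * \<delta>" by blast
      then have pos: "x m - 1 > 0"
        using \<open>\<delta> > 0\<close> beta by (metis less_le_trans mult_pos_pos zero_less_power)
      then obtain k where k: "x (m + Suc k) - 1 \<ge> \<beta> ^ Suc k * (x m - 1) + x (Suc k)"
        using same smaller by fastforce
      have "\<beta> * (\<beta> ^ j * \<delta>) \<le> \<beta> * (x m - 1)" using m beta by (intro mult_left_mono) auto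
      also have "\<dots> \<le> \<beta> ^ Suc k * (x m - 1)"
        using pos beta by (intro mult_right_mono) (auto intro: mult_right_mono[of 1])
      also have "\<dots> \<le> x (m + Suc k) - 1" using k x_nonneg[of "Suc k"] by linarith
      finally show ?case by (auto simp: mult.assoc)
    qed
    have x_bound: "x m \<le> z * (\<Sum>i. real (d 0) * z ^ i)" for m
      unfolding x_def using z bound
      by (intro mult_left_mono suminf_le summ summable_mult summable_geometric) auto
    obtain j where "z * (\<Sum>i. real (d 0) * z ^ i) / \<delta> < \<beta> ^ j"
      using real_arch_pow[OF beta(1)] by blast
    then have "z * (\<Sum>i. real (d 0) * z ^ i) < \<beta> ^ j * \<delta>"
      using \<open>\<delta> > 0\<close> by (simp add: divide_less_eq)
    moreover obtain m where "x m - 1 \<ge> \<beta> ^ j * \<delta>" using grow by blast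
    ultimately show False using x_bound[of m] by linarith
  qed
  show thesis
  proof (cases "\<forall>n. 0 < x n")
    case True
    \<comment> \<open>Positive remainders lie in (0,1], which is exactly the range that fixes a
      digit by the ceiling rule.\<close>
    have ceil: "\<lceil>\<beta> * x n\<rceil> - 1 = int (d n)" for n
    proof -
      have "\<beta> * x n = real (d n) + x (Suc n)" by (simp add: x_Suc)
      then have "\<lceil>\<beta> * x n\<rceil> = int (d n) + 1"
        using True x_le_1[of "Suc n"] by (intro ceiling_unique) auto
      then show ?thesis by simp
    qed
    have "quasi_remainder \<beta> n = x n" for n
      by (induction n) (simp_all only: quasi_remainder.simps x_0 x_Suc ceil of_int_of_nat_eq)
    then have "d = quasi_greedy \<beta>" using beta ceil by (simp add: quasi_greedy_eq fun_eq_iff)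
    then show thesis using that beta by blast
  next
    case False
    then obtain m where "x m = 0" using x_nonneg by (metis less_eq_real_def)
    have zero: "x n = 0" if "m \<le> n" for n
      using that
    proof (induction n rule: dec_induct)
      case (step n)
      then show ?case using x_Suc[of n] x_nonneg[of "Suc n"] by simp
    qed fact
    \<comment> \<open>The floor rule needs remainders below 1. If the shift by \<open>n\<close>
      equals \<open>d\<close>, the value 1 recurs at all multiples of \<open>n\<close>, against the
      zeros from \<open>m\<close> on. Otherwise \<open>smaller\<close> forces
      \<open>x (Suc k) = 0\<close> and \<open>x (n + Suc k) = 1\<close>, although zeros
      persist.\<close>
    have x_less_1: "x n \<noteq> 1" if "1 \<le> n" for n
    proof
      assume "x n = 1"
      show False
      proof (cases "shift n d = d")
        case True
        have "x (m * n) = 1" for m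
        proof (induction m)
          case (Suc m)
          then show ?case using agree[of "m * n" n] True \<open>x n = 1\<close> by simp
        qed (simp add: x_0)
        moreover have "m \<le> m * n" using that by simp
        ultimately show False using zero[of "m * n"] by simp
      next
        case False
        then obtain k where k: "x (n + Suc k) - 1 \<ge> \<beta> ^ Suc k * (x n - 1) + x (Suc k)"
          using smaller by blast
        then have *: "x (Suc k) = 0" "x (n + Suc k) = 1"
          using \<open>x n = 1\<close> x_le_1[of "n + Suc k"] x_nonneg[of "Suc k"] by auto
        have "x (Suc k + j) = 0" for j
        proof (induction j)
          case (Suc j)
          then show ?case using x_Suc[of "Suc k + j"] x_nonneg[of "Suc (Suc k + j)"] by simp
        qed (use * in simp)
        from this[of n] * show False by (simp add: add.commute)
      qed
    qed
    have fl: "\<lfloor>\<beta> * x n\<rfloor> = int (d n)" for n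
    proof -
      have "\<beta> * x n = real (d n) + x (Suc n)" by (simp add: x_Suc)
      then show ?thesis
        using x_nonneg[of "Suc n"] x_le_1[of "Suc n"] x_less_1[of "Suc n"]
        by (intro floor_unique) auto
    qed
    have "beta_remainder \<beta> 1 n = x n" for n
      by (induction n) (simp_all only: beta_remainder.simps x_0 x_Suc fl of_int_of_nat_eq)
    then have "d = beta_expansion \<beta> 1" using fl by (simp add: beta_expansion_def fun_eq_iff)
    then show thesis using that beta by blast
  qed
qed

section \<open>Asymptotics\<close>

locale parry_numeration = subshift_numeration U d + unit_expansion \<beta> d x
  for U d \<beta> x
begin

definition weight :: "nat \<Rightarrow> real" where
  "weight i = real (d i) / \<beta> ^ Suc i"

text \<open>A closed form, through the remainders, of the sum of all weights from index
  \<open>i\<close> on.\<close>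

definition tail :: "nat \<Rightarrow> real" where
  "tail i = x i / \<beta> ^ i"

definition ratio :: "nat \<Rightarrow> real" where
  "ratio n = real (U n) / \<beta> ^ n"

lemma inverse_power_tendsto_0: "(\<lambda>n. (1 / \<beta>) ^ n) \<longlonglongrightarrow> 0"
  using beta by (intro LIMSEQ_realpow_zero) auto

lemma weight_eq: "weight i = tail i - tail (Suc i)"
  using beta by (simp add: weight_def tail_def x_Suc field_simps)

lemma sum_weight: "(\<Sum>i<n. weight i) = 1 - tail n"
  unfolding weight_eq by (subst sum_lessThan_telescope') (simp add: tail_def x_0)

lemma tail_nonneg: "0 \<le> tail i"
  using x_nonneg beta by (simp add: tail_def)

lemma tail_le: "tail i \<le> (1 / \<beta>) ^ i"
  using x_le_1[of i] beta by (simp add: tail_def power_one_over divide_right_mono)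

lemma tail_tendsto_0: "tail \<longlonglongrightarrow> 0"
  by (rule tendsto_sandwich[OF _ _ tendsto_const inverse_power_tendsto_0])
    (simp_all add: tail_nonneg tail_le)

lemma summable_tail: "summable tail"
proof (rule summable_comparison_test')
  show "summable (\<lambda>i. (1 / \<beta>) ^ i)" using beta by (intro summable_geometric) auto
qed (use tail_nonneg tail_le in auto)

lemma suminf_tail_pos: "0 < suminf tail"
  by (rule suminf_pos2[OF summable_tail tail_nonneg, of 0]) (simp add: tail_def x_0)

text \<open>The first digit is \<beta> minus a remainder of at most 1, hence positive; this yields
  \<open>p_0\<close> for the renewal weights.\<close>

lemma d_0_pos: "1 \<le> d 0"
  using x_Suc[of 0] x_0 x_le_1[of 1] beta by simp

sublocale renewal weight tail
proof
  show "weight sums 1"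
    unfolding sums_def sum_weight using tendsto_diff[OF tendsto_const tail_tendsto_0, of 1] by simp
qed (use beta d_0_pos tail_nonneg summable_tail suminf_tail_pos in \<open>auto simp: weight_def\<close>)

text \<open>Summation by parts: the mean of a distribution is the sum of its tails, as the boundary
  term \<open>n * tail n\<close> vanishes. It turns the constant of the renewal theorem into the
  series of the claim.\<close>

lemma weighted_sums: "(\<lambda>i. real (Suc i) * real (d i) / \<beta> ^ Suc i) sums suminf tail"
proof -
  have partial: "(\<Sum>i<n. real (Suc i) * weight i) = (\<Sum>i<n. tail i) - real n * tail n" for n
    by (induction n) (simp_all add: weight_eq algebra_simps)
  have n_tail: "(\<lambda>n. real n * tail n) \<longlonglongrightarrow> 0"
  proof (rule tendsto_sandwich[OF _ _ tendsto_const])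
    show "(\<lambda>n. real n * (1 / \<beta>) ^ n) \<longlonglongrightarrow> 0"
      using beta by (intro powser_times_n_limit_0) auto
  qed (auto intro!: always_eventually mult_left_mono tail_le mult_nonneg_nonneg tail_nonneg)
  have "(\<lambda>n. (\<Sum>i<n. tail i) - real n * tail n) \<longlonglongrightarrow> suminf tail - 0"
    using summable_LIMSEQ[OF summable_tail] n_tail by (rule tendsto_diff)
  then have "(\<lambda>i. real (Suc i) * weight i) sums suminf tail"
    unfolding sums_def partial by simp
  then show ?thesis by (simp add: weight_def)
qed

lemma real_U_eq: "real (U n) = (\<Sum>i<n. real (d i) * real (U (n - Suc i))) + 1"
  using U_eq_word_val[of n] by (simp add: word_val_eq_sum)

lemma ratio_eq: "ratio n = (\<Sum>i<n. weight i * ratio (n - Suc i)) + (1 / \<beta>) ^ n"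
proof -
  have "real (d i) * real (U (n - Suc i)) / \<beta> ^ n = weight i * ratio (n - Suc i)" if "i < n" for i
  proof -
    have "\<beta> ^ n = \<beta> ^ Suc i * \<beta> ^ (n - Suc i)"
      using that by (metis Suc_leI le_add_diff_inverse power_add)
    then show ?thesis by (simp add: weight_def ratio_def)
  qed
  then have "(\<Sum>i<n. weight i * ratio (n - Suc i)) = (\<Sum>i<n. real (d i) * real (U (n - Suc i)) / \<beta> ^ n)"
    by (intro sum.cong) auto
  then show ?thesis
    unfolding ratio_def[of n] real_U_eq[of n]
    by (simp add: add_divide_distrib sum_divide_distrib power_one_over)
qed

text \<open>The second convolution for the renewal theorem. Up to the factor
  \<open>\<beta> ^ n\<close> it is the sum \<open>W n\<close> of remainders times \<open>U\<close>;
  expanding \<open>x (Suc i)\<close> produces the digit sum of the recurrence for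
  \<open>U (Suc n)\<close>, which cancels and leaves
  \<open>W (Suc n) = \<beta> * W n + 1\<close>.\<close>

lemma sum_tail_ratio: "(\<Sum>i<Suc n. tail i * ratio (n - i)) = (\<beta> - (1 / \<beta>) ^ n) / (\<beta> - 1)"
proof -
  define W where "W n = (\<Sum>i<Suc n. x i * real (U (n - i)))" for n
  have W_Suc: "W (Suc n) = \<beta> * W n + 1" for n
  proof -
    have "W (Suc n) = real (U (Suc n)) + (\<Sum>i<Suc n. x (Suc i) * real (U (n - i)))"
      unfolding W_def sum.lessThan_Suc_shift[of _ "Suc n"] by (simp add: x_0)
    also have "(\<Sum>i<Suc n. x (Suc i) * real (U (n - i)))
        = \<beta> * W n - (\<Sum>i<Suc n. real (d i) * real (U (n - i)))"
      unfolding W_def x_Suc sum_distrib_left sum_subtractf[symmetric]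
      by (intro sum.cong refl) (simp add: algebra_simps)
    also have "(\<Sum>i<Suc n. real (d i) * real (U (n - i))) = real (U (Suc n)) - 1"
      using real_U_eq[of "Suc n"] by simp
    finally show ?thesis by simp
  qed
  have "W n * (\<beta> - 1) = \<beta> ^ Suc n - 1"
  proof (induction n)
    case 0
    show ?case by (simp add: W_def x_0)
  next
    case (Suc n)
    have "W (Suc n) * (\<beta> - 1) = \<beta> * (W n * (\<beta> - 1)) + (\<beta> - 1)"
      by (simp add: W_Suc algebra_simps)
    then show ?case unfolding Suc by (simp add: algebra_simps)
  qed
  then have W: "W n = (\<beta> ^ Suc n - 1) / (\<beta> - 1)" using beta by (simp add: eq_divide_eq)
  have "tail i * ratio (n - i) = x i * real (U (n - i)) / \<beta> ^ n" if "i < Suc n" for i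
  proof -
    have "\<beta> ^ n = \<beta> ^ i * \<beta> ^ (n - i)" using that by (simp flip: power_add)
    then show ?thesis by (simp add: tail_def ratio_def)
  qed
  then have "(\<Sum>i<Suc n. tail i * ratio (n - i)) = (\<Sum>i<Suc n. x i * real (U (n - i)) / \<beta> ^ n)"
    by (intro sum.cong) auto
  also have "\<dots> = W n / \<beta> ^ n" unfolding W_def by (rule sum_divide_distrib[symmetric])
  also have "\<dots> = (\<beta> - (1 / \<beta>) ^ n) / (\<beta> - 1)"
    unfolding W using beta by (simp add: field_simps power_one_over)
  finally show ?thesis .
qed

text \<open>Since \<open>tail 0 = 1\<close> and all terms are nonnegative, \<open>ratio n\<close> is
  at most the convolution just computed.\<close>

lemma ratio_bound: "\<bar>ratio n\<bar> \<le> \<beta> / (\<beta> - 1)"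
proof -
  have nonneg: "0 \<le> ratio m" for m using beta by (simp add: ratio_def)
  have "tail 0 * ratio (n - 0) \<le> (\<Sum>i<Suc n. tail i * ratio (n - i))"
    using tail_nonneg nonneg by (intro member_le_sum) auto
  also have "\<dots> \<le> \<beta> / (\<beta> - 1)"
    unfolding sum_tail_ratio using beta by (intro divide_right_mono) auto
  finally show ?thesis using nonneg[of n] by (simp add: tail_def x_0)
qed

lemma ratio_tendsto: "ratio \<longlonglongrightarrow> \<beta> / (\<beta> - 1) / suminf tail"
proof (rule renewal_limit[OF ratio_bound ratio_eq inverse_power_tendsto_0])
  have "(\<lambda>n. (\<beta> - (1 / \<beta>) ^ n) / (\<beta> - 1)) \<longlonglongrightarrow> (\<beta> - 0) / (\<beta> - 1)"
    using beta by (intro tendsto_intros inverse_power_tendsto_0) auto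
  then show "(\<lambda>n. \<Sum>i<Suc n. tail i * ratio (n - i)) \<longlonglongrightarrow> \<beta> / (\<beta> - 1)"
    by (simp only: sum_tail_ratio diff_zero)
qed

lemma U_quotient_tendsto: "(\<lambda>i. real (U (i + 1)) / real (U i)) \<longlonglongrightarrow> \<beta>"
proof -
  let ?l = "\<beta> / (\<beta> - 1) / suminf tail"
  have "?l \<noteq> 0" using beta suminf_tail_pos by simp
  then have "(\<lambda>i. \<beta> * (ratio (Suc i) / ratio i)) \<longlonglongrightarrow> \<beta> * (?l / ?l)"
    by (intro tendsto_intros ratio_tendsto LIMSEQ_Suc[OF ratio_tendsto])
  moreover have "\<beta> * (ratio (Suc i) / ratio i) = real (U (i + 1)) / real (U i)" for i
    using beta by (simp add: ratio_def)
  ultimately show ?thesis using \<open>?l \<noteq> 0\<close> by simp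
qed

lemma asymptotics:
  shows "summable (\<lambda>i. real (Suc i) * real (d i) / \<beta> ^ Suc i)"
    and "(\<lambda>i. real (U i) / \<beta> ^ i) \<longlonglongrightarrow>
           \<beta> / ((\<beta> - 1) * (\<Sum>i. real (Suc i) * real (d i) / \<beta> ^ Suc i))"
  using weighted_sums ratio_tendsto by (simp_all add: sums_iff ratio_def[abs_def])

end

section \<open>The characterisation\<close>

lemma parry_numeration_S:
  assumes "positional_system U" "\<beta> > 1" "numeration_language U = Fac (S \<beta>)"
  shows "parry_numeration U (quasi_greedy \<beta>) \<beta> (quasi_remainder \<beta>)"
proof -
  interpret unit_expansion \<beta> "quasi_greedy \<beta>" "quasi_remainder \<beta>"
    using assms by (intro unit_expansion_quasi_greedy)
  show ?thesis
    using assms quasi_greedy_shift_le Fac_S by unfold_locales (auto simp: positional_system_def)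
qed

lemma parry_numeration_S':
  assumes "positional_system U" "\<beta> > 1" "numeration_language U = Fac (S' \<beta>)"
  shows "parry_numeration U (beta_expansion \<beta> 1) \<beta> (beta_remainder \<beta> 1)"
proof -
  interpret unit_expansion \<beta> "beta_expansion \<beta> 1" "beta_remainder \<beta> 1"
    using assms by (intro unit_expansion_beta_expansion)
  show ?thesis
    using assms beta_expansion_shift_le Fac_S' by unfold_locales (auto simp: positional_system_def)
qed

lemma bertrand_cases:
  assumes "positional_system U" "bertrand U"
  shows "(\<forall>i. U i = i + 1)
    \<or> (\<exists>\<beta>>1. numeration_language U = Fac (S \<beta>))
    \<or> (\<exists>\<beta>>1. numeration_language U = Fac (S' \<beta>))"
proof -
  interpret positional U using assms by unfold_locales (auto simp: positional_system_def)
  obtain d where "subshift_numeration U d" using bertrand_imp_maximal_word assms by blast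
  then interpret subshift_numeration U d .
  show ?thesis
  proof (cases "d = (\<lambda>i. if i = 0 then 1 else 0)")
    \<comment> \<open>For 1000... the recurrence reduces to
      \<open>U (Suc i) = U i + 1\<close>.\<close>
    case True
    have "U i = i + 1" for i
    proof (induction i)
      case (Suc i)
      have "word_val U (pref d (Suc i)) = (\<Sum>j<Suc i. if j = 0 then U i else 0)"
        unfolding word_val_eq_sum by (intro sum.cong) (auto simp: True simp del: upt_Suc)
      then show ?case using U_eq_word_val[of "Suc i"] Suc by simp
    qed simp
    then show ?thesis by blast
  next
    case False
    have "1 \<le> d 0" using U_less_Suc[of 0] U_1 by simp
    then obtain \<beta> where "1 < \<beta>" "d = quasi_greedy \<beta> \<or> d = beta_expansion \<beta> 1"
      using shift_maximal_expansion shift_le False by blast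
    then show ?thesis using language Fac_S Fac_S' by metis
  qed
qed

text \<open>The word 1000... is maximal here: its prefix of length \<open>n + 1\<close> has value
  \<open>U n = n + 1\<close>, which is \<open>U (n + 1) - 1\<close>.\<close>

lemma bertrand_successor:
  assumes "positional_system U" "\<forall>i. U i = i + 1"
  shows "bertrand U"
proof -
  interpret positional U using assms by unfold_locales (auto simp: positional_system_def)
  define d :: "nat \<Rightarrow> nat" where "d = (\<lambda>i. if i = 0 then 1 else 0)"
  have zeros: "greedy U (replicate k 0)" for k using greedy_append_zeros[of k "[]"] by simp
  have val_zeros: "word_val U (replicate k 0) = 0" for k
    using word_val_append_zeros[of k "[]"] by simp
  have pref_Suc: "pref d (Suc n) = 1 # replicate n 0" for n
    by (rule nth_equalityI) (auto simp: d_def nth_Cons' simp del: upt_Suc)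
  have eq: "{w. greedy U w} = subshift_words d"
  proof (rule greedy_eq_subshift_words)
    show "greedy U (pref d n)" for n
      by (cases n) (simp_all add: pref_Suc zeros val_zeros assms del: upt_Suc)
    show "U n = word_val U (pref d n) + 1" for n
      by (cases n) (simp_all add: pref_Suc val_zeros assms del: upt_Suc)
  qed
  show ?thesis
    unfolding bertrand_def numeration_language_eq eq by (simp add: subshift_words_append_0)
qed

theorem theorem2:
  fixes U :: "nat \<Rightarrow> nat"
  assumes "positional_system U"
  shows
    "(bertrand U \<longleftrightarrow>
        (\<forall>i. U i = i + 1)
      \<or> (\<exists>\<beta>::real. \<beta> > 1 \<and> numeration_language U = Fac (S \<beta>))
      \<or> (\<exists>\<beta>::real. \<beta> > 1 \<and> numeration_language U = Fac (S' \<beta>)))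
     \<and>
     (\<forall>\<beta>::real. \<beta> > 1 \<and> numeration_language U = Fac (S \<beta>) \<longrightarrow>
        (\<forall>\<gamma>::real. \<gamma> > 1 \<and> numeration_language U = Fac (S \<gamma>) \<longrightarrow> \<gamma> = \<beta>)
      \<and> alphabet U = {0..nat (\<lceil>\<beta>\<rceil> - 1)}
      \<and> (\<forall>i. U i = (\<Sum>j=1..i. quasi_greedy \<beta> (j - 1) * U (i - j)) + 1)
      \<and> summable (\<lambda>i. real (Suc i) * real (quasi_greedy \<beta> i) / \<beta> ^ Suc i)
      \<and> (\<lambda>i. real (U i) / \<beta> ^ i) \<longlonglongrightarrow>
           \<beta> / ((\<beta> - 1) * (\<Sum>i. real (Suc i) * real (quasi_greedy \<beta> i) / \<beta> ^ Suc i))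
      \<and> (\<lambda>i. real (U (i + 1)) / real (U i)) \<longlonglongrightarrow> \<beta>)
     \<and>
     (\<forall>\<beta>::real. \<beta> > 1 \<and> numeration_language U = Fac (S' \<beta>) \<longrightarrow>
        (\<forall>\<gamma>::real. \<gamma> > 1 \<and> numeration_language U = Fac (S' \<gamma>) \<longrightarrow> \<gamma> = \<beta>)
      \<and> alphabet U = {0..nat \<lfloor>\<beta>\<rfloor>}
      \<and> (\<forall>i. U i = (\<Sum>j=1..i. beta_expansion \<beta> 1 (j - 1) * U (i - j)) + 1)
      \<and> summable (\<lambda>i. real (Suc i) * real (beta_expansion \<beta> 1 i) / \<beta> ^ Suc i)
      \<and> (\<lambda>i. real (U i) / \<beta> ^ i) \<longlonglongrightarrow>
           \<beta> / ((\<beta> - 1) * (\<Sum>i. real (Suc i) * real (beta_expansion \<beta> 1 i) / \<beta> ^ Suc i))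
      \<and> (\<lambda>i. real (U (i + 1)) / real (U i)) \<longlonglongrightarrow> \<beta>)"
proof (intro conjI allI impI; (elim conjE)?)
  note S = parry_numeration_S[OF assms] and S' = parry_numeration_S'[OF assms]
  show "bertrand U \<longleftrightarrow>
        (\<forall>i. U i = i + 1)
      \<or> (\<exists>\<beta>::real. \<beta> > 1 \<and> numeration_language U = Fac (S \<beta>))
      \<or> (\<exists>\<beta>::real. \<beta> > 1 \<and> numeration_language U = Fac (S' \<beta>))"
    using bertrand_cases[OF assms] bertrand_successor[OF assms]
      S[THEN parry_numeration.axioms(1), THEN subshift_numeration.bertrand_U]
      S'[THEN parry_numeration.axioms(1), THEN subshift_numeration.bertrand_U]
    by blast
  \<comment> \<open>Uniqueness: both bases are the limit of the same quotients
    \<open>U (i + 1) / U i\<close>.\<close>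
  {
    fix \<beta> \<gamma> :: real
    assume "1 < \<beta>" "numeration_language U = Fac (S \<beta>)"
      and "1 < \<gamma>" "numeration_language U = Fac (S \<gamma>)"
    then show "\<gamma> = \<beta>"
      using S[THEN parry_numeration.U_quotient_tendsto] LIMSEQ_unique by blast
  }
  {
    fix \<beta> \<gamma> :: real
    assume "1 < \<beta>" "numeration_language U = Fac (S' \<beta>)"
      and "1 < \<gamma>" "numeration_language U = Fac (S' \<gamma>)"
    then show "\<gamma> = \<beta>"
      using S'[THEN parry_numeration.U_quotient_tendsto] LIMSEQ_unique by blast
  }
next
  fix \<beta> :: real assume \<beta>: "1 < \<beta>" "numeration_language U = Fac (S \<beta>)"
  then interpret parry_numeration U "quasi_greedy \<beta>" \<beta> "quasi_remainder \<beta>"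
    using parry_numeration_S[OF assms] by blast
  show "alphabet U = {0..nat (\<lceil>\<beta>\<rceil> - 1)}" using alphabet_eq quasi_greedy_0[OF \<beta>(1)] by simp
  show "U i = (\<Sum>j=1..i. quasi_greedy \<beta> (j - 1) * U (i - j)) + 1" for i by (rule U_eq)
  show "summable (\<lambda>i. real (Suc i) * real (quasi_greedy \<beta> i) / \<beta> ^ Suc i)"
    and "(\<lambda>i. real (U i) / \<beta> ^ i) \<longlonglongrightarrow>
           \<beta> / ((\<beta> - 1) * (\<Sum>i. real (Suc i) * real (quasi_greedy \<beta> i) / \<beta> ^ Suc i))"
    by (rule asymptotics)+
  show "(\<lambda>i. real (U (i + 1)) / real (U i)) \<longlonglongrightarrow> \<beta>" by (rule U_quotient_tendsto)
next
  fix \<beta> :: real assume \<beta>: "1 < \<beta>" "numeration_language U = Fac (S' \<beta>)"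
  then interpret parry_numeration U "beta_expansion \<beta> 1" \<beta> "beta_remainder \<beta> 1"
    using parry_numeration_S'[OF assms] by blast
  show "alphabet U = {0..nat \<lfloor>\<beta>\<rfloor>}" using alphabet_eq beta_expansion_0 by simp
  show "U i = (\<Sum>j=1..i. beta_expansion \<beta> 1 (j - 1) * U (i - j)) + 1" for i by (rule U_eq)
  show "summable (\<lambda>i. real (Suc i) * real (beta_expansion \<beta> 1 i) / \<beta> ^ Suc i)"
    and "(\<lambda>i. real (U i) / \<beta> ^ i) \<longlonglongrightarrow>
           \<beta> / ((\<beta> - 1) * (\<Sum>i. real (Suc i) * real (beta_expansion \<beta> 1 i) / \<beta> ^ Suc i))"
    by (rule asymptotics)+
  show "(\<lambda>i. real (U (i + 1)) / real (U i)) \<longlonglongrightarrow> \<beta>" by (rule U_quotient_tendsto)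
qed

end
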